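(* Let $K$ be a compact Calderón–Zygmund kernel on $\mathbb R^n$ with parameter $0<\delta<1$ and auxiliary functions $L,S,D$, and let $T$ be a linear operator associated with $K$ which satisfies the weak compactness condition with function $F_W$. Let $\delta<\alpha\le 1$. Then for all cubes $I,J\subset\mathbb R^n$ and all bump functions $\psi_I,\psi_J$ adapted to and supported on $I,J$ respectively, with constant $C>0$, order one and parameter $\alpha$, and such that $\psi_{I\wedge J}$ has mean zero: (i) if $\mathrm{rdist}(I,J)\le 3$, then $$ |\langle T(\psi_I),\psi_J\rangle|\lesssim C^2\,\frac{\mathrm{ec}(I,J)^{\frac12}}{\mathrm{rdist}(I,J)^{n+\delta}}\,F(I,J) $$ with $F(I,J)=\tilde F_K(I\wedge J)+F_W(I\wedge J)+F_K(I\wedge J,\, I\wedge J,\, I\vee J)$; (ii) if $\mathrm{rdist}(I,J)>3$, then $$ |\langle T(\psi_I),\psi_J\rangle|\lesssim C^2\,\frac{\mathrm{ec}(I,J)^{\frac12+\frac{\delta}{n}}}{\mathrm{rdist}(I,J)^{n+\delta}}\,F_K(\langle I,J\rangle,\, I\wedge J,\, \langle I,J\rangle). $$ The implicit constants depend only on $T$, $\delta$ and $\alpha$.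
   Context: **Cubes.** A cube is $I=\prod_{i=1}^n[a_i,b_i]$ with all $b_i-a_i>0$ equal; $c(I)$ is its centre, $\ell(I)$ its side length, $|I|=\ell(I)^n$; $\lambda I$ is the cube with the same centre and side $\lambda\ell(I)$. $|\cdot|_\infty$ is the max norm on $\mathbb R^n$, $\mathbb B=[-1/2,1/2]^n$. $\langle I,J\rangle$ is the cube containing $I\cup J$ with smallest possible side length and whose centre has smallest possible first coordinate (any fixed choice if this is not unique); $\mathrm{diam}(I\cup J)=\ell(\langle I,J\rangle)$. For points, $\langle t,x\rangle$ is defined the same way, treating points as degenerate cubes. Put $$\mathrm{rdist}(I,J)=\frac{\mathrm{diam}(I\cup J)}{\max(\ell(I),\ell(J))},\qquad \mathrm{ec}(I,J)=\frac{\min(|I|,|J|)}{\max(|I|,|J|)}.$$ If $\ell(J)\le\ell(I)$ then $I\wedge J=J$, $I\vee J=I$; otherwise $I\wedge J=I$, $I\vee J=J$. **Kernel.** $K$ is defined on $\{(t,x)\in\mathbb R^n\times\mathbb R^n: t\ne x\}$ with values in $\mathbb C$. $L,S,D:[0,\infty)\to[0,\infty)$ are bounded, $L,D$ non-increasing, $S$ non-decreasing, with $\lim_{y\to\infty}L(y)=\lim_{y\to0}S(y)=\lim_{y\to\infty}D(y)=0$. That $K$ is a compact Calderón–Zygmund kernel with parameter $\delta$ and functions $L,S,D$ means (this is the working form of the definition): for some constant $C_K>0$, $$|K(t,x)-K(t',x')|\le C_K\frac{(|t-t'|_\infty+|x-x'|_\infty)^{\delta}}{|t-x|_\infty^{n+\delta}}\,L(|t-x|_\infty)\,S(|t-t'|_\infty+|x-x'|_\infty)\,D\Big(1+\frac{|t+x|_\infty}{1+|t-x|_\infty}\Big)$$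 whenever $2(|t-t'|_\infty+|x-x'|_\infty)<|t-x|_\infty$, and $$|K(t,x)|\le C_K\frac{1}{|t-x|_\infty^{n}}\,L(|t-x|_\infty)\,S(|t-x|_\infty)\,D\Big(1+\frac{|t+x|_\infty}{1+|t-x|_\infty}\Big)\quad (t\neq x).$$ **Functions $F_K$, $\tilde F_K$.** For cubes $I_1,I_2,I_3$, $$F_K(I_1,I_2,I_3)=L(\ell(I_1))\,S(\ell(I_2))\,D(\mathrm{rdist}(I_3,\mathbb B)),\qquad \tilde F_K(I_1,I_2,I_3)=L(\ell(I_1))\,S(\ell(I_2))\sum_{j\ge0}2^{-j\delta}D(\mathrm{rdist}(2^jI_3,\mathbb B)),$$ and $\tilde F_K(I)=\tilde F_K(I,I,I)$. **Convention on constants.** Universal constants inside the arguments of $L,S,D$ are omitted: an estimate involving $F_K$, $\tilde F_K$ is understood to hold after replacing $L,S,D$ in their definitions by $L(\kappa\,\cdot),S(\kappa^{-1}\cdot),D(\kappa\,\cdot)$ for some constant $\kappa\in(0,1]$ depending only on $n$ and $\delta$. **Operator.** $\mathcal C_0(\mathbb R^n)$ denotes the continuous functions with compact support. $T:\mathcal C_0(\mathbb R^n)\to\mathcal C_0(\mathbb R^n)'$ is continuous and linear, with (bilinear) dual pairing $\langle T(f),g\rangle$. It is associated with $K$ if $\langle T(f),g\rangle=\iint f(t)g(x)K(x,t)\,dt\,dx$ for all $f,g\in\mathcal C_0(\mathbb R^n)$ with disjoint compact supports. **Bump functions** ($L^2$-normalized). Fix a decay exponent $N\in\mathbb N$. A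 bounded $\phi$ is a bump function adapted to $I$ with constant $C$, decay $N$, order $0$ if $|\phi(x)|\le C|I|^{-1/2}\big(1+\frac{|x-c(I)|_\infty}{\ell(I)}\big)^{-N}$ for all $x$. A continuous bounded $\phi$ is a bump function adapted to $I$ with constant $C$, decay $N$, order one and parameter $\alpha\in(0,1]$ if moreover, for all $t,x$, $$|\phi(t)-\phi(x)|\le C\Big(\frac{|t-x|_\infty}{\ell(I)}\Big)^{\alpha}|I|^{-1/2}\sup_{r\in\langle t,x\rangle}\Big(1+\frac{|r-c(I)|_\infty}{\ell(I)}\Big)^{-N}.$$ Bump functions in the claim have decay $N$. **Weak compactness condition.** There is a bounded function $F_W$ from cubes to $[0,\infty)$ with $\lim_{\ell(I)\to\infty}F_W(I)=\lim_{\ell(I)\to0}F_W(I)=\lim_{|c(I)|_\infty\to\infty}F_W(I)=0$ such that $|\langle T(\phi_I),\varphi_I\rangle|\lesssim C^2F_W(I)$ for every cube $I$ and all bump functions $\phi_I,\varphi_I$ (in $\mathcal C_0(\mathbb R^n)$) adapted to $I$ with constant $C$, decay $N$, order $0$, the implicit constant depending only on $T$. *)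

theory Defs
  imports "HOL-Analysis.Analysis"
begin

text \<open>
  A cube is given by its centre and its side length; \<^term>\<open>side Q = 0\<close> gives points as
  degenerate cubes, which are only needed to define the smallest enclosing cube of two points.
  The max norm on \<^typ>\<open>real ^ 'n\<close> is \<^const>\<open>infnorm\<close>. The index type is linearly ordered
  so that "first coordinate" makes sense.
\<close>

datatype 'n cube = Cube (centre: "real ^ ('n::finite)") (side: real)

definition is_cube :: "('n::finite) cube \<Rightarrow> bool" where
  "is_cube I \<longleftrightarrow> side I > 0"

text \<open>Here \<^term>\<open>1 :: real ^ 'n\<close> is the vector all of whose coordinates are 1.\<close>

definition cube_set :: "('n::finite) cube \<Rightarrow> (real ^ 'n) set" where
  "cube_set I = cbox (centre I - (side I / 2) *\<^sub>R 1) (centre I + (side I / 2) *\<^sub>R 1)"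

definition vol :: "('n::finite) cube \<Rightarrow> real" where
  "vol I = side I ^ CARD('n)"

definition dilate :: "real \<Rightarrow> ('n::finite) cube \<Rightarrow> 'n cube" where
  "dilate r I = Cube (centre I) (r * side I)"

definition unit_cube :: "('n::finite) cube" where
  "unit_cube = Cube 0 1"

definition smallest_cube :: "(real ^ 'n) set \<Rightarrow> ('n::finite) cube \<Rightarrow> bool" where
  "smallest_cube A Q \<longleftrightarrow> side Q \<ge> 0 \<and> A \<subseteq> cube_set Q \<and>
     (\<forall>R. side R \<ge> 0 \<and> A \<subseteq> cube_set R \<longrightarrow> side Q \<le> side R)"

text \<open>
  In dimension at least 2 a smallest cube whose centre has minimal first coordinate need not be
  unique, so a fixed choice is made.
\<close>

definition cube_hull :: "(real ^ ('n::{finite,linorder})) set \<Rightarrow> 'n cube" where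
  "cube_hull A = (SOME Q. smallest_cube A Q \<and>
     (\<forall>R. smallest_cube A R \<longrightarrow> centre Q $ Min UNIV \<le> centre R $ Min UNIV))"

definition cube_join :: "('n::{finite,linorder}) cube \<Rightarrow> 'n cube \<Rightarrow> 'n cube" where
  "cube_join I J = cube_hull (cube_set I \<union> cube_set J)"

definition rdist :: "('n::{finite,linorder}) cube \<Rightarrow> 'n cube \<Rightarrow> real" where
  "rdist I J = side (cube_join I J) / max (side I) (side J)"

definition ec :: "('n::finite) cube \<Rightarrow> 'n cube \<Rightarrow> real" where
  "ec I J = min (vol I) (vol J) / max (vol I) (vol J)"

definition smaller :: "('n::finite) cube \<Rightarrow> 'n cube \<Rightarrow> 'n cube" where
  "smaller I J = (if side J \<le> side I then J else I)"

definition larger :: "('n::finite) cube \<Rightarrow> 'n cube \<Rightarrow> 'n cube" where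
  "larger I J = (if side J \<le> side I then I else J)"

text \<open>Only the values of \<^term>\<open>L\<close>, \<^term>\<open>S\<close>, \<^term>\<open>D\<close> on the half-line from 0 matter.\<close>

definition admissible_LSD :: "(real \<Rightarrow> real) \<Rightarrow> (real \<Rightarrow> real) \<Rightarrow> (real \<Rightarrow> real) \<Rightarrow> bool" where
  "admissible_LSD L S D \<longleftrightarrow>
     (\<forall>y\<ge>0. L y \<ge> 0 \<and> S y \<ge> 0 \<and> D y \<ge> 0) \<and>
     bounded (L ` {0..}) \<and> bounded (S ` {0..}) \<and> bounded (D ` {0..}) \<and>
     antimono_on {0..} L \<and> mono_on {0..} S \<and> antimono_on {0..} D \<and>
     (L \<longlongrightarrow> 0) at_top \<and> (S \<longlongrightarrow> 0) (at_right 0) \<and> (D \<longlongrightarrow> 0) at_top"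

text \<open>The values of \<^term>\<open>K\<close> on the diagonal are irrelevant.\<close>

definition compact_CZ_kernel ::
  "real \<Rightarrow> (real \<Rightarrow> real) \<Rightarrow> (real \<Rightarrow> real) \<Rightarrow> (real \<Rightarrow> real) \<Rightarrow>
   (real ^ 'n \<Rightarrow> real ^ ('n::finite) \<Rightarrow> complex) \<Rightarrow> bool" where
  "compact_CZ_kernel \<delta> L S D K \<longleftrightarrow> admissible_LSD L S D \<and>
     (\<exists>C\<^sub>K>0.
        (\<forall>t x t' x'. 2 * (infnorm (t - t') + infnorm (x - x')) < infnorm (t - x) \<longrightarrow>
           cmod (K t x - K t' x') \<le>
             C\<^sub>K * ((infnorm (t - t') + infnorm (x - x')) powr \<delta> /
                   infnorm (t - x) powr (real CARD('n) + \<delta>)) *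
             L (infnorm (t - x)) * S (infnorm (t - t') + infnorm (x - x')) *
             D (1 + infnorm (t + x) / (1 + infnorm (t - x)))) \<and>
        (\<forall>t x. t \<noteq> x \<longrightarrow>
           cmod (K t x) \<le>
             C\<^sub>K * (1 / infnorm (t - x) ^ CARD('n)) *
             L (infnorm (t - x)) * S (infnorm (t - x)) *
             D (1 + infnorm (t + x) / (1 + infnorm (t - x)))))"

definition F_K ::
  "(real \<Rightarrow> real) \<Rightarrow> (real \<Rightarrow> real) \<Rightarrow> (real \<Rightarrow> real) \<Rightarrow>
   'n cube \<Rightarrow> 'n cube \<Rightarrow> ('n::{finite,linorder}) cube \<Rightarrow> real" where
  "F_K L S D I1 I2 I3 = L (side I1) * S (side I2) * D (rdist I3 unit_cube)"

definition tilde_F_K3 ::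
  "real \<Rightarrow> (real \<Rightarrow> real) \<Rightarrow> (real \<Rightarrow> real) \<Rightarrow> (real \<Rightarrow> real) \<Rightarrow>
   'n cube \<Rightarrow> 'n cube \<Rightarrow> ('n::{finite,linorder}) cube \<Rightarrow> real" where
  "tilde_F_K3 \<delta> L S D I1 I2 I3 =
     L (side I1) * S (side I2) *
     (\<Sum>j::nat. 2 powr (- real j * \<delta>) * D (rdist (dilate (2 ^ j) I3) unit_cube))"

definition tilde_F_K ::
  "real \<Rightarrow> (real \<Rightarrow> real) \<Rightarrow> (real \<Rightarrow> real) \<Rightarrow> (real \<Rightarrow> real) \<Rightarrow>
   ('n::{finite,linorder}) cube \<Rightarrow> real" where
  "tilde_F_K \<delta> L S D I = tilde_F_K3 \<delta> L S D I I I"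

definition supp :: "(real ^ ('n::finite) \<Rightarrow> complex) \<Rightarrow> (real ^ 'n) set" where
  "supp f = closure {x. f x \<noteq> 0}"

definition C0 :: "(real ^ ('n::finite) \<Rightarrow> complex) set" where
  "C0 = {f. continuous_on UNIV f \<and> compact (supp f)}"

text \<open>
  The dual of \<^const>\<open>C0\<close> for its usual inductive limit topology: the functionals that are
  linear and sup-norm bounded on the functions supported in any fixed compact set.
\<close>

definition C0_dual :: "((real ^ ('n::finite) \<Rightarrow> complex) \<Rightarrow> complex) set" where
  "C0_dual = {\<Lambda>.
     (\<forall>f\<in>C0. \<forall>g\<in>C0. \<Lambda> (\<lambda>x. f x + g x) = \<Lambda> f + \<Lambda> g) \<and>
     (\<forall>f\<in>C0. \<forall>a. \<Lambda> (\<lambda>x. a * f x) = a * \<Lambda> f) \<and>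
     (\<forall>Q. compact Q \<longrightarrow>
        (\<exists>M. \<forall>f\<in>C0. supp f \<subseteq> Q \<longrightarrow> cmod (\<Lambda> f) \<le> M * (SUP x. cmod (f x))))}"

text \<open>
  The pairing of \<^term>\<open>T f\<close> with \<^term>\<open>g\<close> is \<^term>\<open>T f g\<close>. The second conjunct says that
  \<^term>\<open>T\<close> is linear and continuous into the dual with its weak-* topology (by uniform
  boundedness this is the same as continuity into the strong dual).
\<close>

definition C0_operator ::
  "((real ^ ('n::finite) \<Rightarrow> complex) \<Rightarrow> (real ^ 'n \<Rightarrow> complex) \<Rightarrow> complex) \<Rightarrow> bool" where
  "C0_operator T \<longleftrightarrow> (\<forall>f\<in>C0. T f \<in> C0_dual) \<and> (\<forall>g\<in>C0. (\<lambda>f. T f g) \<in> C0_dual)"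

definition associated_with ::
  "((real ^ ('n::finite) \<Rightarrow> complex) \<Rightarrow> (real ^ 'n \<Rightarrow> complex) \<Rightarrow> complex) \<Rightarrow>
   (real ^ 'n \<Rightarrow> real ^ 'n \<Rightarrow> complex) \<Rightarrow> bool" where
  "associated_with T K \<longleftrightarrow>
     (\<forall>f\<in>C0. \<forall>g\<in>C0. supp f \<inter> supp g = {} \<longrightarrow>
        T f g = (LINT x|lborel. LINT t|lborel. f t * g x * K x t))"

definition decay :: "nat \<Rightarrow> ('n::finite) cube \<Rightarrow> real ^ 'n \<Rightarrow> real" where
  "decay N I x = (1 + infnorm (x - centre I) / side I) powr (- real N)"

definition bump0 ::
  "nat \<Rightarrow> ('n::finite) cube \<Rightarrow> real \<Rightarrow> (real ^ 'n \<Rightarrow> complex) \<Rightarrow> bool" where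
  "bump0 N I C \<phi> \<longleftrightarrow> bounded (range \<phi>) \<and>
     (\<forall>x. cmod (\<phi> x) \<le> C * vol I powr (- (1/2)) * decay N I x)"

definition bump1 ::
  "nat \<Rightarrow> real \<Rightarrow> 'n cube \<Rightarrow> real \<Rightarrow> (real ^ ('n::{finite,linorder}) \<Rightarrow> complex) \<Rightarrow> bool" where
  "bump1 N \<alpha> I C \<phi> \<longleftrightarrow> continuous_on UNIV \<phi> \<and> bump0 N I C \<phi> \<and>
     (\<forall>t x. cmod (\<phi> t - \<phi> x) \<le>
        C * (infnorm (t - x) / side I) powr \<alpha> * vol I powr (- (1/2)) *
        (SUP r\<in>cube_set (cube_hull {t, x}). decay N I r))"

definition weak_compactness ::
  "nat \<Rightarrow> ((real ^ ('n::finite) \<Rightarrow> complex) \<Rightarrow> (real ^ 'n \<Rightarrow> complex) \<Rightarrow> complex) \<Rightarrow>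
   ('n cube \<Rightarrow> real) \<Rightarrow> bool" where
  "weak_compactness N T F\<^sub>W \<longleftrightarrow>
     (\<forall>I. is_cube I \<longrightarrow> F\<^sub>W I \<ge> 0) \<and> bounded (F\<^sub>W ` Collect is_cube) \<and>
     (F\<^sub>W \<longlongrightarrow> 0) (inf (filtercomap side at_top) (principal (Collect is_cube))) \<and>
     (F\<^sub>W \<longlongrightarrow> 0) (inf (filtercomap side (at_right 0)) (principal (Collect is_cube))) \<and>
     (F\<^sub>W \<longlongrightarrow> 0) (inf (filtercomap (\<lambda>I. infnorm (centre I)) at_top)
                       (principal (Collect is_cube))) \<and>
     (\<exists>A>0. \<forall>I C \<phi> \<eta>. is_cube I \<and> C > 0 \<and> \<phi> \<in> C0 \<and> \<eta> \<in> C0 \<and> bump0 N I C \<phi> \<and> bump0 N I C \<eta>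
        \<longrightarrow> cmod (T \<phi> \<eta>) \<le> A * C\<^sup>2 * F\<^sub>W I)"

end

theory Submission
  imports Defs
begin

text \<open>
  By transposing \<^term>\<open>T\<close> and its kernel one may assume that \<^term>\<open>J\<close> is the smaller cube.
  Wherever the supports are separated, the mean zero of \<^term>\<open>\<psi>\<^sub>J\<close> replaces the kernel by
  its increment from the centre of \<^term>\<open>J\<close>, and the smoothness estimate applies with
  \<^term>\<open>\<kappa> = 1/2\<close>. This settles (ii) directly. In (i), a cutoff at scale \<^term>\<open>side J\<close>
  splits off the part of \<^term>\<open>\<psi>\<^sub>I\<close> near \<^term>\<open>J\<close>: up to the factor
  \<^term>\<open>sqrt (vol J / vol I)\<close> it is an order 0 bump adapted to \<^term>\<open>J\<close>, so weak
  compactness controls it. The rest is separated from \<^term>\<open>J\<close>, and its kernel bound is summed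
  over the dyadic dilates of \<^term>\<open>J\<close>, which produces the series in \<^const>\<open>tilde_F_K\<close>.
\<close>

section \<open>Cubes and their joins\<close>

lemma infnorm_le_iff: "infnorm (x :: real ^ 'n) \<le> r \<longleftrightarrow> (\<forall>i. \<bar>x $ i\<bar> \<le> r)"
  by (subst infnorm_Max) (auto simp: Basis_vec_def inner_axis)

lemma mem_cube_set: "x \<in> cube_set I \<longleftrightarrow> infnorm (x - centre I) \<le> side I / 2"
  unfolding cube_set_def mem_box_cart infnorm_le_iff
  by (intro all_cong1) (simp add: abs_le_iff le_diff_eq diff_le_eq minus_le_iff add.commute, smt (verit) field_sum_of_halves)

lemma compact_cube_set [simp]: "compact (cube_set I)"
  by (simp add: cube_set_def)

lemma centre_in_cube_set: "side I \<ge> 0 \<Longrightarrow> centre I \<in> cube_set I"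
  by (simp add: mem_cube_set infnorm_0)

lemma infnorm_diff_le_side:
  assumes "x \<in> cube_set I" "y \<in> cube_set I"
  shows "infnorm (x - y) \<le> side I"
  using assms infnorm_triangle[of "x - centre I" "centre I - y"]
  by (auto simp: mem_cube_set infnorm_sub[of "centre I" y])

lemma measure_cube_set:
  assumes "side I \<ge> 0"
  shows "measure lborel (cube_set I) = vol I"
proof -
  have "cube_set I \<noteq> {}" using centre_in_cube_set[OF assms] by blast
  then show ?thesis
    unfolding cube_set_def vol_def by (subst content_cbox_cart) auto
qed

lemma integrable_indicator_cube: "integrable lborel (indicator (cube_set I) :: _ \<Rightarrow> real)"
  unfolding cube_set_def by (intro integrable_real_indicator) (use emeasure_lborel_cbox_finite in auto)

section \<open>The smallest cube around two cubes\<close>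

lemma cube_union_subset_iff:
  assumes "side I \<ge> 0" "side J \<ge> 0"
  shows "cube_set I \<union> cube_set J \<subseteq> cube_set R \<longleftrightarrow>
    (\<forall>i. max (centre I $ i + side I / 2) (centre J $ i + side J / 2) \<le> centre R $ i + side R / 2 \<and>
         centre R $ i - side R / 2 \<le> min (centre I $ i - side I / 2) (centre J $ i - side J / 2))"
proof -
  have "cube_set Q \<subseteq> cube_set R \<longleftrightarrow> (\<forall>i. centre Q $ i + side Q / 2 \<le> centre R $ i + side R / 2 \<and>
         centre R $ i - side R / 2 \<le> centre Q $ i - side Q / 2)" if "side Q \<ge> 0" for Q :: "'a cube"
    unfolding cube_set_def subset_interval_cart using that by (auto simp: algebra_simps)
  then show ?thesis using assms by auto
qed

text \<open>\<open>cube_hull\<close> is defined by choice, so its properties are available only once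
  some cube satisfies the defining condition. The side is forced coordinatewise: two intervals span
  at least the longer of them, and at least the distance of their midpoints plus half of each
  length; the worst coordinate turns that distance into the max norm.\<close>

lemma
  assumes "side I \<ge> 0" "side J \<ge> 0"
  shows smallest_cube_join: "smallest_cube (cube_set I \<union> cube_set J) (cube_join I J)"
    and side_cube_join: "side (cube_join I J) =
      max (max (side I) (side J)) (infnorm (centre I - centre J) + (side I + side J) / 2)"
proof -
  let ?A = "cube_set I \<union> cube_set J"
  define s where "s = max (max (side I) (side J)) (infnorm (centre I - centre J) + (side I + side J) / 2)"
  \<comment> \<open>In every coordinate \<open>Q\<close> ends exactly at the upper end of the union.
    This is the lowest position open to a cube of side \<open>s\<close>, so the first coordinate of
    its centre is minimal.\<close>
  define Q where "Q = Cube (\<chi> i. max (centre I $ i + side I / 2) (centre J $ i + side J / 2) - s / 2) s"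
  have s: "side Q = s" "s \<ge> 0" using assms by (auto simp: Q_def s_def)
  have s1: "side I \<le> s" "side J \<le> s" "infnorm (centre I - centre J) + (side I + side J) / 2 \<le> s"
    by (auto simp: s_def)
  have le: "\<bar>centre I $ i - centre J $ i\<bar> \<le> infnorm (centre I - centre J)" for i
    using infnorm_le_iff[of "centre I - centre J"] by auto
  have sub: "?A \<subseteq> cube_set Q"
    unfolding cube_union_subset_iff[OF assms]
  proof
    fix i
    show "max (centre I $ i + side I / 2) (centre J $ i + side J / 2) \<le> centre Q $ i + side Q / 2 \<and>
         centre Q $ i - side Q / 2 \<le> min (centre I $ i - side I / 2) (centre J $ i - side J / 2)"
      using le[of i] assms s1 by (auto simp: Q_def diff_le_eq abs_le_iff add_divide_distrib)
  qed
  have min: "s \<le> side R" if "?A \<subseteq> cube_set R" for R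
  proof -
    note R = that[unfolded cube_union_subset_iff[OF assms], rule_format]
    have "infnorm (centre I - centre J) \<le> side R - (side I + side J) / 2"
      unfolding infnorm_le_iff
    proof
      fix i show "\<bar>(centre I - centre J) $ i\<bar> \<le> side R - (side I + side J) / 2"
        using R[of i] by (auto simp: abs_le_iff add_divide_distrib)
    qed
    \<comment> \<open>Any one coordinate will do, since both intervals have full side length in each
      of them.\<close>
    moreover have "max (side I) (side J) \<le> side R" using R[of undefined] by auto
    ultimately show ?thesis by (simp add: s_def)
  qed
  have Q: "smallest_cube ?A Q" using sub min s by (auto simp: smallest_cube_def)
  have side: "side R = s" if "smallest_cube ?A R" for R
    using that Q s by (auto simp: smallest_cube_def intro!: antisym)
  have "smallest_cube ?A Q \<and> (\<forall>R. smallest_cube ?A R \<longrightarrow> centre Q $ Min UNIV \<le> centre R $ Min UNIV)"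
  proof (intro conjI allI impI)
    fix R assume R: "smallest_cube ?A R"
    then have "max (centre I $ i + side I / 2) (centre J $ i + side J / 2) \<le> centre R $ i + side R / 2" for i
      using cube_union_subset_iff[OF assms] by (auto simp: smallest_cube_def)
    then show "centre Q $ Min UNIV \<le> centre R $ Min UNIV"
      using side[OF R] by (simp add: Q_def algebra_simps)
  qed (rule Q)
  from someI[of "\<lambda>Q. smallest_cube ?A Q \<and>
     (\<forall>R. smallest_cube ?A R \<longrightarrow> centre Q $ Min UNIV \<le> centre R $ Min UNIV)", OF this]
  show 1: "smallest_cube ?A (cube_join I J)"
    by (simp add: cube_join_def cube_hull_def)
  show "side (cube_join I J) =
      max (max (side I) (side J)) (infnorm (centre I - centre J) + (side I + side J) / 2)"
    using side[OF 1] by (simp add: s_def)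
qed

lemma cube_join_commute: "cube_join I J = cube_join J I"
  by (simp add: cube_join_def Un_commute)

lemma rdist_commute: "rdist I J = rdist J I"
  by (simp add: rdist_def cube_join_commute[of I J] max.commute)

lemma ec_commute: "ec I J = ec J I"
  by (simp add: ec_def max.commute min.commute)

lemma rdist_ge_1:
  assumes "side I > 0" "side J \<ge> 0"
  shows "rdist I J \<ge> 1"
proof -
  have "0 < max (side I) (side J)" "max (side I) (side J) \<le> side (cube_join I J)"
    using assms by (auto simp: side_cube_join)
  then show ?thesis by (simp add: rdist_def)
qed

text \<open>Converts the argument of \<open>D\<close> in the kernel bounds into a relative distance;
  as \<open>D\<close> is non-increasing, this is the source of the factor 1/2 inside
  \<open>D\<close>. Both sides are comparable to 1 + |c(H)| / max(side H, 1), because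
  \<open>t + x\<close> differs from twice the centre by at most \<open>side H\<close>.\<close>

lemma rdist_unit_cube_le:
  assumes "t \<in> cube_set H" "x \<in> cube_set H"
  shows "rdist H unit_cube / 2 \<le> 1 + infnorm (t + x) / (1 + infnorm (t - x))"
proof -
  \<comment> \<open>\<open>m\<close> is the denominator of \<open>rdist H unit_cube\<close>.\<close>
  define m where "m = max (side H) 1"
  have m: "side H \<le> m" "1 \<le> m" by (auto simp: m_def)
  have H: "side H \<ge> 0" using assms(1) infnorm_pos_le[of "t - centre H"] by (auto simp: mem_cube_set)
  have tx: "infnorm (t - x) \<le> side H" using assms by (rule infnorm_diff_le_side)
  have "infnorm (2 *\<^sub>R centre H) \<le> infnorm (t + x) + infnorm ((centre H - t) + (centre H - x))"
    using infnorm_triangle[of "t + x" "(centre H - t) + (centre H - x)"]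
    by (simp add: algebra_simps scaleR_2)
  also have "infnorm ((centre H - t) + (centre H - x)) \<le> side H"
    using infnorm_triangle[of "centre H - t" "centre H - x"] assms
    by (auto simp: mem_cube_set infnorm_sub[of "centre H"])
  finally have c: "2 * infnorm (centre H) \<le> infnorm (t + x) + side H"
    by (simp add: infnorm_mul)
  have "side (cube_join H unit_cube) \<le> max m (infnorm (centre H) + (side H + 1) / 2)"
    using H by (auto simp: side_cube_join unit_cube_def m_def)
  also have "\<dots> \<le> infnorm (t + x) / 2 + 3 / 2 * m"
    using c infnorm_pos_le[of "t + x"] m by (auto simp: add_divide_distrib)
  finally have "rdist H unit_cube \<le> (infnorm (t + x) / 2 + 3 / 2 * m) / m"
    by (auto simp: rdist_def unit_cube_def m_def intro!: divide_right_mono)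
  also have "\<dots> = infnorm (t + x) / (2 * m) + 3 / 2" by (auto simp: m_def field_simps)
  \<comment> \<open>This is 1 + |t - x| \<le> 2m, from |t - x| \<le> side H \<le> m and 1 \<le>
    m.\<close>
  also have "infnorm (t + x) / (2 * m) \<le> infnorm (t + x) / (1 + infnorm (t - x))"
    using tx infnorm_pos_le[of "t - x"] infnorm_pos_le[of "t + x"]
    by (intro divide_left_mono) (auto simp: m_def intro!: mult_pos_pos)
  finally have "rdist H unit_cube \<le> infnorm (t + x) / (1 + infnorm (t - x)) + 3 / 2" by simp
  moreover have "0 \<le> infnorm (t + x) / (1 + infnorm (t - x))" by (simp add: infnorm_pos_le add_nonneg_nonneg)
  ultimately show ?thesis by linarith
qed

section \<open>Kernels and operators\<close>

lemma C0_vanishes: "x \<notin> supp f \<Longrightarrow> f x = 0"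
  using closure_subset[of "{x. f x \<noteq> 0}"] by (auto simp: supp_def)

lemma indicator_supp_mult: "indicator (supp f) x *\<^sub>R f x = f x"
  using C0_vanishes[of x f] by (cases "x \<in> supp f") auto

lemma C0_I:
  assumes "continuous_on UNIV f" "supp f \<subseteq> cube_set I"
  shows "f \<in> C0"
proof -
  have "compact (cube_set I \<inter> supp f)" by (intro compact_Int_closed) (simp_all add: supp_def)
  with assms show ?thesis by (simp add: C0_def Int_absorb1)
qed

lemma supp_mult_subset: "supp (\<lambda>x. f x * g x) \<subseteq> supp g"
  unfolding supp_def by (rule closure_mono) auto

section \<open>Smoothness and off-diagonal continuity of the kernel\<close>

definition CZ_smooth :: "real \<Rightarrow> real \<Rightarrow> (real \<Rightarrow> real) \<Rightarrow> (real \<Rightarrow> real) \<Rightarrow> (real \<Rightarrow> real) \<Rightarrow>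
   (real ^ 'n \<Rightarrow> real ^ ('n::finite) \<Rightarrow> complex) \<Rightarrow> bool" where
  "CZ_smooth CK \<delta> L S D K \<longleftrightarrow>
    (\<forall>t x t' x'. 2 * (infnorm (t - t') + infnorm (x - x')) < infnorm (t - x) \<longrightarrow>
      cmod (K t x - K t' x') \<le>
      CK * ((infnorm (t - t') + infnorm (x - x')) powr \<delta> /
            infnorm (t - x) powr (real CARD('n) + \<delta>)) *
      L (infnorm (t - x)) * S (infnorm (t - t') + infnorm (x - x')) *
      D (1 + infnorm (t + x) / (1 + infnorm (t - x))))"

lemma CZ_smoothD:
  fixes K :: "real ^ ('n::finite) \<Rightarrow> real ^ 'n \<Rightarrow> complex"
  assumes "CZ_smooth CK \<delta> L S D K" "2 * (infnorm (t - t') + infnorm (x - x')) < infnorm (t - x)"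
  shows "cmod (K t x - K t' x') \<le>
      CK * ((infnorm (t - t') + infnorm (x - x')) powr \<delta> /
            infnorm (t - x) powr (real CARD('n) + \<delta>)) *
      L (infnorm (t - x)) * S (infnorm (t - t') + infnorm (x - x')) *
      D (1 + infnorm (t + x) / (1 + infnorm (t - x)))"
  using assms unfolding CZ_smooth_def by simp

lemma compact_CZ_kernel_smooth:
  assumes "compact_CZ_kernel \<delta> L S D K"
  obtains CK where "CK > 0" "CZ_smooth CK \<delta> L S D K"
  using assms unfolding compact_CZ_kernel_def by (elim conjE exE) (rule that; simp add: CZ_smooth_def)

text \<open>The two variables enter the hypothesis and the bound only through |t - x|, |t + x| and
  the sum of the two increments, all symmetric under exchange. So the constant and \<open>L\<close>,
  \<open>S\<close>, \<open>D\<close> are inherited unchanged.\<close>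

lemma CZ_smooth_transpose:
  fixes K :: "real ^ ('n::finite) \<Rightarrow> real ^ 'n \<Rightarrow> complex"
  assumes "CZ_smooth CK \<delta> L S D K"
  shows "CZ_smooth CK \<delta> L S D (\<lambda>x t. K t x)"
  unfolding CZ_smooth_def
proof (intro allI impI)
  have *: "infnorm (x - t) = infnorm (t - x)" "x + t = t + x" for x t :: "real ^ 'n"
    by (simp_all add: infnorm_sub add.commute)
  fix t x t' x' :: "real ^ 'n"
  assume "2 * (infnorm (t - t') + infnorm (x - x')) < infnorm (t - x)"
  then show "cmod (K x t - K x' t') \<le>
      CK * ((infnorm (t - t') + infnorm (x - x')) powr \<delta> /
            infnorm (t - x) powr (real CARD('n) + \<delta>)) *
      L (infnorm (t - x)) * S (infnorm (t - t') + infnorm (x - x')) *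
      D (1 + infnorm (t + x) / (1 + infnorm (t - x)))"
    using CZ_smoothD[OF assms, of x x' t t'] by (simp add: *[of x t] add.commute[of "infnorm (x - x')"])
qed

text \<open>Supplies the integrability of kernel integrals over compact sets off the diagonal, and
  hence Fubini. Close to an off-diagonal point the smoothness estimate applies, and since
  \<open>S\<close> is bounded it is a Hoelder estimate of exponent \<delta>.\<close>

lemma CZ_smooth_continuous:
  fixes K :: "real ^ ('n::finite) \<Rightarrow> real ^ 'n \<Rightarrow> complex"
  assumes adm: "admissible_LSD L S D" and K: "CZ_smooth CK \<delta> L S D K" and "CK > 0" "\<delta> > 0"
  shows "continuous_on {p. fst p \<noteq> snd p} (\<lambda>p. K (fst p) (snd p))"
proof (intro continuous_at_imp_continuous_on ballI)
  fix p :: "(real ^ 'n) \<times> (real ^ 'n)" assume "p \<in> {p. fst p \<noteq> snd p}"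
  then have p: "infnorm (fst p - snd p) > 0" by (simp add: infnorm_pos_lt)
  let ?t = "fst p" and ?x = "snd p"
  define r where "r q = infnorm (?t - fst q) + infnorm (?x - snd q)" for q
  obtain M where M: "\<And>y. y \<ge> 0 \<Longrightarrow> S y \<le> M"
    using adm unfolding admissible_LSD_def bounded_real by fastforce
  \<comment> \<open>\<open>B\<close> collects the factors that depend on \<open>p\<close> alone;
    only a power of \<open>r q\<close> and the bounded factor \<open>S (r q)\<close> remain.\<close>
  define B where "B = CK / infnorm (?t - ?x) powr (real CARD('n) + \<delta>) * L (infnorm (?t - ?x)) *
    D (1 + infnorm (?t + ?x) / (1 + infnorm (?t - ?x)))"
  have arg: "0 \<le> 1 + infnorm (?t + ?x) / (1 + infnorm (?t - ?x))"
    by (simp add: infnorm_pos_le add_nonneg_nonneg)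
  have B: "B \<ge> 0" unfolding B_def
    using adm \<open>CK > 0\<close> p arg by (auto simp: admissible_LSD_def intro!: mult_nonneg_nonneg)
  have r0: "(r \<longlongrightarrow> 0) (at p)"
  proof -
    have "(r \<longlongrightarrow> r p) (at p)"
      unfolding r_def by (intro tendsto_intros)
    then show ?thesis by (simp add: r_def infnorm_0)
  qed
  have ev: "\<forall>\<^sub>F q in at p. 2 * r q < infnorm (?t - ?x)"
    using order_tendstoD(2)[OF r0, of "infnorm (?t - ?x) / 2"] p by (auto elim: eventually_mono)
  have "((\<lambda>q. K (fst p) (snd p) - K (fst q) (snd q)) \<longlongrightarrow> 0) (at p)"
  proof (rule Lim_null_comparison)
    show "\<forall>\<^sub>F q in at p. cmod (K (fst p) (snd p) - K (fst q) (snd q)) \<le> B * M * r q powr \<delta>"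
      using ev
    proof eventually_elim
      case (elim q)
      have r: "r q \<ge> 0" by (simp add: r_def infnorm_pos_le add_nonneg_nonneg)
      have "cmod (K (fst p) (snd p) - K (fst q) (snd q)) \<le> B * r q powr \<delta> * S (r q)"
        using CZ_smoothD[OF K elim[unfolded r_def]] by (simp add: B_def r_def mult_ac)
      also have "\<dots> \<le> B * r q powr \<delta> * M"
        using B M[OF r] by (intro mult_left_mono) auto
      finally show ?case by (simp add: mult_ac)
    qed
    have "((\<lambda>q. B * M * r q powr \<delta>) \<longlongrightarrow> B * M * 0) (at p)"
      using \<open>\<delta> > 0\<close> by (intro tendsto_mult tendsto_const tendsto_zero_powrI[OF r0])
        (auto simp: r_def infnorm_pos_le add_nonneg_nonneg)
    then show "((\<lambda>q. B * M * r q powr \<delta>) \<longlongrightarrow> 0) (at p)" by simp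
  qed
  then show "isCont (\<lambda>p. K (fst p) (snd p)) p"
    unfolding isCont_def by (subst LIM_zero_iff[symmetric]) (drule tendsto_minus, simp)
qed

section \<open>Passage to the transposed operator\<close>

lemma C0_operator_transpose: "C0_operator T \<Longrightarrow> C0_operator (\<lambda>f g. T g f)"
  by (auto simp: C0_operator_def)

lemma weak_compactness_transpose:
  assumes "weak_compactness N T F\<^sub>W"
  shows "weak_compactness N (\<lambda>f g. T g f) F\<^sub>W"
  unfolding weak_compactness_def
proof (intro conjI)
  obtain A where "A > 0" and A: "\<forall>I C \<phi> \<eta>. is_cube I \<and> C > 0 \<and> \<phi> \<in> C0 \<and> \<eta> \<in> C0 \<and>
      bump0 N I C \<phi> \<and> bump0 N I C \<eta> \<longrightarrow> cmod (T \<phi> \<eta>) \<le> A * C\<^sup>2 * F\<^sub>W I"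
    using assms unfolding weak_compactness_def by (elim conjE exE) (rule that)
  then show "\<exists>A>0. \<forall>I C \<phi> \<eta>. is_cube I \<and> C > 0 \<and> \<phi> \<in> C0 \<and> \<eta> \<in> C0 \<and>
      bump0 N I C \<phi> \<and> bump0 N I C \<eta> \<longrightarrow> cmod (T \<eta> \<phi>) \<le> A * C\<^sup>2 * F\<^sub>W I"
    by (intro exI[of _ A] conjI allI impI A[rule_format]) auto
qed (use assms in \<open>simp_all add: weak_compactness_def\<close>)

text \<open>Exchanging the two functions reverses the order of integration. Fubini applies because
  disjoint compact supports have a compact product that misses the diagonal, where the integrand is
  continuous.\<close>

lemma associated_with_transpose:
  fixes K :: "real ^ ('n::finite) \<Rightarrow> real ^ 'n \<Rightarrow> complex"
  assumes T: "associated_with T K"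
    and K: "continuous_on {p. fst p \<noteq> snd p} (\<lambda>p. K (fst p) (snd p))"
  shows "associated_with (\<lambda>f g. T g f) (\<lambda>x t. K t x)"
  unfolding associated_with_def
proof (intro ballI impI)
  fix f g :: "real ^ 'n \<Rightarrow> complex"
  assume fg: "f \<in> C0" "g \<in> C0" "supp f \<inter> supp g = {}"
  let ?h = "\<lambda>p. g (snd p) * f (fst p) * K (fst p) (snd p)"
  have "continuous_on (supp f \<times> supp g) ?h"
  proof (intro continuous_on_mult)
    show "continuous_on (supp f \<times> supp g) (\<lambda>p. g (snd p))"
      by (rule continuous_on_compose2[of UNIV g _ snd]) (use fg(2) in \<open>auto simp: C0_def intro: continuous_on_snd\<close>)
    show "continuous_on (supp f \<times> supp g) (\<lambda>p. f (fst p))"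
      by (rule continuous_on_compose2[of UNIV f _ fst]) (use fg(1) in \<open>auto simp: C0_def intro: continuous_on_fst\<close>)
    show "continuous_on (supp f \<times> supp g) (\<lambda>p. K (fst p) (snd p))"
      by (rule continuous_on_subset[OF K]) (use fg(3) in auto)
  qed
  then have "integrable lborel (\<lambda>p. indicator (supp f \<times> supp g) p *\<^sub>R ?h p)"
    using fg(1,2) by (intro borel_integrable_compact compact_Times) (auto simp: C0_def)
  also have "(\<lambda>p. indicator (supp f \<times> supp g) p *\<^sub>R ?h p) = (\<lambda>(x, t). g t * f x * K x t)"
  proof
    fix p
    show "indicator (supp f \<times> supp g) p *\<^sub>R ?h p = (\<lambda>(x, t). g t * f x * K x t) p"
      using C0_vanishes[of "fst p" f] C0_vanishes[of "snd p" g]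
      by (cases p) (auto simp: indicator_def)
  qed
  finally have int: "integrable (lborel \<Otimes>\<^sub>M lborel) (\<lambda>(x, t). g t * f x * K x t)"
    by (simp add: lborel_prod)
  have "T g f = (LINT x|lborel. LINT t|lborel. g t * f x * K x t)"
    using T fg unfolding associated_with_def by blast
  also have "\<dots> = (LINT x|lborel. LINT t|lborel. f t * g x * K t x)"
    using lborel_pair.Fubini_integral[OF int] by (simp only: mult.commute[of "g _" "f _"])
  finally show "T g f = (LINT x|lborel. LINT t|lborel. f t * g x * K t x)" .
qed

section \<open>Separated supports\<close>

text \<open>The pairing is the integral of \<open>g\<close> against the kernel integral
  \<open>G\<close> of \<open>f\<close>. As \<open>g\<close> has mean zero, the constant
  \<open>G (centre J)\<close> may be subtracted, so only kernel increments from the centre of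
  \<open>J\<close> matter. The majorant \<open>U\<close> is left open so that both a single cube and
  a sum over dyadic cubes can be inserted.\<close>

lemma far_pairing_bound:
  fixes K :: "real ^ ('n::finite) \<Rightarrow> real ^ 'n \<Rightarrow> complex"
  assumes T: "associated_with T K"
    and K: "continuous_on {p. fst p \<noteq> snd p} (\<lambda>p. K (fst p) (snd p))"
    and J: "is_cube J" and f: "f \<in> C0" "supp f \<inter> cube_set J = {}"
    and g: "g \<in> C0" "supp g \<subseteq> cube_set J" "(LINT x|lborel. g x) = 0" "\<And>x. cmod (g x) \<le> b"
    and U: "integrable lborel U" "\<And>t. t \<notin> supp f \<Longrightarrow> 0 \<le> U t"
      "\<And>x t. x \<in> cube_set J \<Longrightarrow> t \<in> supp f \<Longrightarrow> cmod (f t) * cmod (K x t - K (centre J) t) \<le> U t"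
  shows "cmod (T f g) \<le> b * vol J * (LINT t|lborel. U t)"
proof -
  define G where "G x = (LINT t|lborel. f t * K x t)" for x
  have b: "b \<ge> 0" using g(4) norm_ge_zero order_trans by blast
  have cJ: "centre J \<in> cube_set J" using J by (intro centre_in_cube_set) (simp add: is_cube_def)
  have fK: "integrable lborel (\<lambda>t. f t * K x t)" if "x \<in> cube_set J" for x
  proof -
    have "continuous_on (supp f) (\<lambda>t. f t * K x t)"
    proof (intro continuous_intros)
      show "continuous_on (supp f) f" using f(1) continuous_on_subset by (auto simp: C0_def)
      show "continuous_on (supp f) (K x)"
      proof -
        have "continuous_on (supp f) (\<lambda>t. K (fst (x, t)) (snd (x, t)))"
          by (rule continuous_on_compose2[OF K])
             (use that f(2) in \<open>auto intro!: continuous_on_Pair continuous_on_const continuous_on_id\<close>)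
        then show ?thesis by simp
      qed
    qed
    then have "integrable lborel (\<lambda>t. indicator (supp f) t *\<^sub>R (f t * K x t))"
      using f(1) by (intro borel_integrable_compact) (auto simp: C0_def)
    also have "(\<lambda>t. indicator (supp f) t *\<^sub>R (f t * K x t)) = (\<lambda>t. f t * K x t)"
      using indicator_supp_mult[of f] by (simp only: mult_scaleR_left[symmetric])
    finally show ?thesis .
  qed
  have G: "cmod (G x - G (centre J)) \<le> (LINT t|lborel. U t)" if x: "x \<in> cube_set J" for x
  proof -
    have "G x - G (centre J) = (LINT t|lborel. f t * K x t - f t * K (centre J) t)"
      unfolding G_def by (intro Bochner_Integration.integral_diff[symmetric] fK x cJ)
    also have "cmod \<dots> \<le> (LINT t|lborel. U t)"
    proof (rule Bochner_Integration.integral_norm_bound_integral)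
      fix t
      show "cmod (f t * K x t - f t * K (centre J) t) \<le> U t"
        using U(2)[of t] U(3)[OF x, of t] C0_vanishes[of t f]
        by (cases "t \<in> supp f") (auto simp: right_diff_distrib[symmetric] norm_mult)
    qed (intro Bochner_Integration.integrable_diff fK x cJ U(1))+
    finally show ?thesis .
  qed
  \<comment> \<open>At the centre the left-hand side of \<open>G\<close> is 0, so nonnegativity of
    the integral of \<open>U\<close> comes for free.\<close>
  have U0: "0 \<le> (LINT t|lborel. U t)" using G[OF cJ] by simp
  have "T f g = (LINT x|lborel. LINT t|lborel. f t * g x * K x t)"
    using T f g(1,2) unfolding associated_with_def by blast
  also have "\<dots> = (LINT x|lborel. g x * G x)"
    unfolding G_def by (simp add: mult_ac flip: integral_mult_right_zero)
  \<comment> \<open>If the outer integrand is not integrable its integral is 0, so no measurability of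
    \<^term>\<open>G\<close> is needed.\<close>
  also have "cmod \<dots> \<le> b * vol J * (LINT t|lborel. U t)"
  proof (cases "integrable lborel (\<lambda>x. g x * G x)")
    case True
    have gint: "integrable lborel g"
    proof -
      have "integrable lborel (\<lambda>x. indicator (supp g) x *\<^sub>R g x)"
        using g(1) by (intro borel_integrable_compact) (auto simp: C0_def intro: continuous_on_subset)
      also have "(\<lambda>x. indicator (supp g) x *\<^sub>R g x) = g"
        by (simp add: indicator_supp_mult)
      finally show ?thesis .
    qed
    have "(LINT x|lborel. g x * G x) = (LINT x|lborel. g x * G x - g x * G (centre J))"
      using True gint g(3) by (subst Bochner_Integration.integral_diff) auto
    also have "cmod \<dots> \<le> (LINT x|lborel. b * (LINT t|lborel. U t) * indicator (cube_set J) x)"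
    proof (rule Bochner_Integration.integral_norm_bound_integral)
      fix x
      show "cmod (g x * G x - g x * G (centre J)) \<le> b * (LINT t|lborel. U t) * indicator (cube_set J) x"
      proof (cases "x \<in> cube_set J")
        case True
        then show ?thesis
          using G[OF True] g(4)[of x] b by (auto simp: right_diff_distrib[symmetric] norm_mult intro!: mult_mono)
      next
        case False
        then show ?thesis using g(2) C0_vanishes[of x g] by auto
      qed
    qed (use True gint integrable_indicator_cube in auto)
    also have "\<dots> = b * vol J * (LINT t|lborel. U t)"
      using J by (simp add: measure_cube_set is_cube_def)
    finally show ?thesis .
  next
    case False
    then show ?thesis using b U0 J by (simp add: not_integrable_integral_eq vol_def is_cube_def)
  qed
  finally show ?thesis .
qed

text \<open>A uniform form of the smoothness estimate, with \<open>t\<close> replaced by data of the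
  region in which it lies. The lower bounds \<open>r\<close> and \<open>l\<close> for the distance
  are separate because the power has to follow the dyadic scale while the argument of
  \<open>L\<close> stays at the scale of \<open>J\<close>; \<open>H\<close> is any cube holding both
  \<open>t\<close> and the centre of \<open>J\<close>.\<close>

lemma kernel_increment_bound:
  fixes K :: "real ^ ('n::{finite,linorder}) \<Rightarrow> real ^ ('n::{finite,linorder}) \<Rightarrow> complex"
  assumes adm: "admissible_LSD L S D" and "CK > 0" "\<delta> > 0"
    and K: "CZ_smooth CK \<delta> L S D K"
    and x: "x \<in> cube_set J" and t: "side J < infnorm (t - centre J)"
    and H: "centre J \<in> cube_set H" "t \<in> cube_set H"
    and r: "0 < r" "r \<le> infnorm (t - centre J)" and l: "0 \<le> l" "l \<le> infnorm (t - centre J)"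
  shows "cmod (K x t - K (centre J) t) \<le>
    CK * (side J powr \<delta> / r powr (real CARD('n) + \<delta>)) * (L l * S (2 * side J) * D (rdist H unit_cube / 2))"
proof -
  define c where "c = centre J"
  have LSD: "\<And>y. 0 \<le> y \<Longrightarrow> 0 \<le> L y" "\<And>y. 0 \<le> y \<Longrightarrow> 0 \<le> S y" "\<And>y. 0 \<le> y \<Longrightarrow> 0 \<le> D y"
    "antimono_on {0..} L" "mono_on {0..} S" "antimono_on {0..} D"
    using adm by (simp_all add: admissible_LSD_def)
  have tc: "infnorm (c - t) = infnorm (t - c)" by (rule infnorm_sub)
  have xc: "infnorm (c - x) \<le> side J / 2" using x by (simp add: mem_cube_set c_def infnorm_sub)
  have J: "side J \<ge> 0" using xc infnorm_pos_le[of "c - x"] by simp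
  have Hs: "side H \<ge> 0" using H(1) infnorm_pos_le[of "centre J - centre H"] by (simp add: mem_cube_set)
  have rd: "0 \<le> rdist H unit_cube"
    unfolding rdist_commute[of H] using rdist_ge_1[of unit_cube H] Hs by (simp add: unit_cube_def)
  have "cmod (K x t - K c t) = cmod (K c t - K x t)" by (rule norm_minus_commute)
  \<comment> \<open>The base point is \<open>(c, t)\<close> and the increment runs from
    \<open>c\<close> to \<open>x\<close>. Its size is at most half of \<open>side J\<close>, so
    twice it stays below |t - c|, and the bound features |t - c| rather than |t - x|.\<close>
  also have "\<dots> \<le> CK * (infnorm (c - x) powr \<delta> / infnorm (t - c) powr (real CARD('n) + \<delta>)) *
      L (infnorm (t - c)) * S (infnorm (c - x)) * D (1 + infnorm (c + t) / (1 + infnorm (t - c)))"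
    using CZ_smoothD[OF K, of c x t t] xc t[folded c_def] by (simp add: tc infnorm_0)
  also have "\<dots> = CK * (infnorm (c - x) powr \<delta> / infnorm (t - c) powr (real CARD('n) + \<delta>)) *
      (L (infnorm (t - c)) * S (infnorm (c - x)) * D (1 + infnorm (c + t) / (1 + infnorm (t - c))))"
    by (simp only: mult.assoc)
  also have "\<dots> \<le> CK * (side J powr \<delta> / r powr (real CARD('n) + \<delta>)) *
      (L l * S (2 * side J) * D (rdist H unit_cube / 2))"
  proof (intro mult_mono mult_nonneg_nonneg)
    show "infnorm (c - x) powr \<delta> / infnorm (t - c) powr (real CARD('n) + \<delta>) \<le>
        side J powr \<delta> / r powr (real CARD('n) + \<delta>)"
      using xc J r \<open>\<delta> > 0\<close> by (intro frac_le powr_mono2) (auto simp: c_def infnorm_pos_le)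
    show "L (infnorm (t - c)) \<le> L l"
      using monotone_onD[OF LSD(4), of l "infnorm (t - c)"] l by (simp add: c_def)
    \<comment> \<open>The increment is at most \<open>side J / 2\<close>; the looser argument
      \<open>2 * side J\<close> gives \<open>S\<close> the form that goes with \<kappa> =
      1/2.\<close>
    show "S (infnorm (c - x)) \<le> S (2 * side J)"
      using xc J by (intro mono_onD[OF LSD(5)]) (auto simp: infnorm_pos_le)
    show "D (1 + infnorm (c + t) / (1 + infnorm (t - c))) \<le> D (rdist H unit_cube / 2)"
      using monotone_onD[OF LSD(6), of "rdist H unit_cube / 2" "1 + infnorm (c + t) / (1 + infnorm (t - c))"]
        rdist_unit_cube_le[OF H] rd by (simp add: tc flip: c_def)
  qed (use LSD(1-3) \<open>CK > 0\<close> l J rd in \<open>auto simp: infnorm_pos_le add_nonneg_nonneg\<close>)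
  finally show ?thesis by (simp add: c_def)
qed

text \<open>A relative distance above 3 makes the distance from any point of \<open>I\<close> to the
  centre of \<open>J\<close> comparable to the side \<open>d\<close> of the join. One bound
  \<open>B\<close> for the increment then serves on all of \<open>I\<close>, and integrating it
  costs only the factor \<open>vol I\<close>. Working with \<open>d / 2\<close> produces the power
  of 2 and the halved argument of \<open>L\<close>.\<close>

lemma far_estimate_separated:
  fixes K :: "real ^ ('n::{finite,linorder}) \<Rightarrow> real ^ ('n::{finite,linorder}) \<Rightarrow> complex"
  assumes adm: "admissible_LSD L S D" and CK: "CK > 0" and \<delta>: "\<delta> > 0"
    and K: "CZ_smooth CK \<delta> L S D K"
    and T: "associated_with T K"
    and cont: "continuous_on {p. fst p \<noteq> snd p} (\<lambda>p. K (fst p) (snd p))"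
    and I: "is_cube I" and J: "is_cube J" "side J \<le> side I" and rd: "rdist I J > 3"
    and f: "f \<in> C0" "supp f \<subseteq> cube_set I" "\<And>t. cmod (f t) \<le> a"
    and g: "g \<in> C0" "supp g \<subseteq> cube_set J" "(LINT x|lborel. g x) = 0" "\<And>x. cmod (g x) \<le> b"
  shows "cmod (T f g) \<le> a * b * (vol I * vol J) *
    (CK * 2 powr (real CARD('n) + \<delta>) * (side J powr \<delta> / side (cube_join I J) powr (real CARD('n) + \<delta>))) *
    F_K (\<lambda>y. L (y / 2)) (\<lambda>y. S (2 * y)) (\<lambda>y. D (y / 2)) (cube_join I J) J (cube_join I J)"
proof -
  define H where "H = cube_join I J"
  define d where "d = side H"
  define B where "B = CK * (side J powr \<delta> / (d / 2) powr (real CARD('n) + \<delta>)) *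
    (L (d / 2) * S (2 * side J) * D (rdist H unit_cube / 2))"
  have s: "side I > 0" "side J > 0" using I J by (auto simp: is_cube_def)
  have HH: "cube_set I \<union> cube_set J \<subseteq> cube_set H"
    using smallest_cube_join[of I J] s by (auto simp: smallest_cube_def H_def)
  have d3: "d > 3 * side I" using rd J s by (simp add: rdist_def d_def H_def max_absorb1 field_simps)
  \<comment> \<open>Since \<open>d\<close> exceeds both sides, the maximum in
    \<open>side_cube_join\<close> is attained by the distance term.\<close>
  then have d: "d = infnorm (centre I - centre J) + (side I + side J) / 2"
    using J(2) s unfolding d_def H_def by (simp add: side_cube_join max_def split: if_splits)
  have far: "d / 2 \<le> infnorm (t - centre J)" if "t \<in> cube_set I" for t
  proof -
    have "infnorm (centre I - centre J) \<le> infnorm (centre I - t) + infnorm (t - centre J)"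
      using infnorm_triangle[of "centre I - t" "t - centre J"] by simp
    moreover have "infnorm (centre I - t) \<le> side I / 2" using that by (simp add: mem_cube_set infnorm_sub)
    \<comment> \<open>The distance is at least d - side I - side J / 2, and what is subtracted is at
      most 3/2 \<open>side I\<close>, less than d/2.\<close>
    ultimately show ?thesis
      using d d3 J(2) by (simp add: add_divide_distrib)
  qed
  have cJ: "centre J \<in> cube_set J" using s by (intro centre_in_cube_set) simp
  have "cmod (T f g) \<le> b * vol J * (LINT t|lborel. a * B * indicator (cube_set I) t)"
  proof (rule far_pairing_bound[OF T cont J(1) f(1) _ g])
    show "supp f \<inter> cube_set J = {}"
    proof -
      have "t \<notin> cube_set J" if "t \<in> cube_set I" for t
        using far[OF that] d3 J(2) s by (simp add: mem_cube_set)
      then show ?thesis using f(2) by blast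
    qed
    have a: "a \<ge> 0" using f(3) norm_ge_zero order_trans by blast
    have key: "cmod (K x t - K (centre J) t) \<le> B" if "x \<in> cube_set J" "t \<in> cube_set I" for x t
      unfolding B_def using far[OF that(2)] d3 J(2) s that HH cJ
      by (intro kernel_increment_bound[OF adm CK \<delta> K that(1)]) auto
    have "0 \<le> B" using key[OF cJ centre_in_cube_set] s norm_ge_zero order_trans less_imp_le by blast
    then show "0 \<le> a * B * indicator (cube_set I) t" for t using a by simp
    show "integrable lborel (\<lambda>t. a * B * indicator (cube_set I) t)"
      by (simp add: integrable_indicator_cube)
    show "cmod (f t) * cmod (K x t - K (centre J) t) \<le> a * B * indicator (cube_set I) t"
      if "x \<in> cube_set J" "t \<in> supp f" for x t
    proof -
      have t: "t \<in> cube_set I" using f(2) that(2) by blast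
      show ?thesis using mult_mono[OF f(3) key[OF that(1) t] a] t by simp
    qed
  qed
  also have "\<dots> = b * vol J * (a * B * vol I)"
    using s by (simp add: measure_cube_set)
  also have "B = CK * 2 powr (real CARD('n) + \<delta>) * (side J powr \<delta> / d powr (real CARD('n) + \<delta>)) *
    F_K (\<lambda>y. L (y / 2)) (\<lambda>y. S (2 * y)) (\<lambda>y. D (y / 2)) H J H"
    using d3 s by (simp add: B_def F_K_def d_def powr_divide)
  finally show ?thesis by (simp add: mult_ac d_def H_def)
qed

section \<open>The series over dyadic dilates of the smaller cube\<close>

lemma summable_tilde_F_K:
  assumes adm: "admissible_LSD L S D" and \<delta>: "\<delta> > 0" and "side I \<ge> 0"
  shows "summable (\<lambda>j. 2 powr (- real j * \<delta>) * D (rdist (dilate (2 ^ j) I) unit_cube / 2))"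
proof -
  obtain M where M: "\<And>y. y \<ge> 0 \<Longrightarrow> D y \<le> M" "\<And>y. y \<ge> 0 \<Longrightarrow> D y \<ge> 0"
    using adm unfolding admissible_LSD_def bounded_real by fastforce
  have rd: "0 \<le> rdist (dilate (2 ^ j) I) unit_cube" for j
    unfolding rdist_commute[of _ unit_cube] using rdist_ge_1[of unit_cube "dilate (2 ^ j) I"] assms(3)
    by (simp add: unit_cube_def dilate_def)
  \<comment> \<open>\<open>D\<close> is bounded by \<open>M\<close>, so a geometric series of ratio
    2^(-\<delta>) dominates.\<close>
  have "2 powr (- \<delta>) < 1" using \<delta> by (simp add: powr_less_one)
  then have "summable (\<lambda>j. (2 powr (- \<delta>)) ^ j * M)"
    by (intro summable_mult2 summable_geometric) simp
  then show ?thesis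
  proof (rule summable_comparison_test')
    show "norm (2 powr (- real j * \<delta>) * D (rdist (dilate (2 ^ j) I) unit_cube / 2)) \<le> (2 powr (- \<delta>)) ^ j * M" for j
      using M[of "rdist (dilate (2 ^ j) I) unit_cube / 2"] rd[of j]
      by (simp add: powr_realpow[symmetric] powr_powr mult.commute)
  qed
qed

text \<open>At distance about 2^k l from the centre, with \<open>l = side J\<close>, the increment
  is of order l^\<delta> / (2^k l)^(n + \<delta>), and the k-th dilate has volume (2^k l)^n. Their
  product decays like 2^(-k \<delta>), the weight in \<open>tilde_F_K\<close>. Only the sup bound of
  \<open>f\<close> enters, not the size of its support.\<close>

lemma far_estimate_dyadic:
  fixes K :: "real ^ ('n::{finite,linorder}) \<Rightarrow> real ^ ('n::{finite,linorder}) \<Rightarrow> complex"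
  assumes adm: "admissible_LSD L S D" and CK: "CK > 0" and \<delta>: "\<delta> > 0"
    and K: "CZ_smooth CK \<delta> L S D K"
    and T: "associated_with T K"
    and cont: "continuous_on {p. fst p \<noteq> snd p} (\<lambda>p. K (fst p) (snd p))"
    and J: "is_cube J"
    and f: "f \<in> C0" "\<And>t. t \<in> supp f \<Longrightarrow> side J < infnorm (t - centre J)" "\<And>t. cmod (f t) \<le> a"
    and g: "g \<in> C0" "supp g \<subseteq> cube_set J" "(LINT x|lborel. g x) = 0" "\<And>x. cmod (g x) \<le> b"
  shows "cmod (T f g) \<le> a * b * vol J * (CK * 4 powr (real CARD('n) + \<delta>) *
    tilde_F_K \<delta> (\<lambda>y. L (y / 2)) (\<lambda>y. S (2 * y)) (\<lambda>y. D (y / 2)) J)"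
proof -
  define l where "l = side J"
  define c where "c = centre J"
  define Q where "Q k = dilate (2 ^ k) J" for k :: nat
  define E where "E k = D (rdist (Q k) unit_cube / 2)" for k
  define B where "B k = CK * (l powr \<delta> / (2 ^ k * l / 4) powr (real CARD('n) + \<delta>)) *
    (L (l / 2) * S (2 * l) * E k)" for k
  have l: "l > 0" using J by (simp add: is_cube_def l_def)
  have Q: "centre (Q k) = c" "side (Q k) = 2 ^ k * l" for k by (simp_all add: Q_def dilate_def l_def c_def)
  have a: "a \<ge> 0" and b: "b \<ge> 0" using f(3) g(4) norm_ge_zero order_trans by blast+
  have nonneg: "0 \<le> L (l / 2)" "0 \<le> S (2 * l)" "0 \<le> E k" for k
  proof -
    have "0 \<le> rdist (Q k) unit_cube"
      unfolding rdist_commute[of _ unit_cube] using rdist_ge_1[of unit_cube "Q k"] l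
      by (simp add: unit_cube_def Q)
    then show "0 \<le> L (l / 2)" "0 \<le> S (2 * l)" "0 \<le> E k"
      using adm l by (simp_all add: admissible_LSD_def E_def)
  qed
  have B: "0 \<le> B k" for k unfolding B_def using CK nonneg by (intro mult_nonneg_nonneg) auto
  have vol_Q: "vol (Q k) = (2 ^ k * l) powr real CARD('n)" for k
    using l by (simp add: vol_def Q powr_realpow)
  \<comment> \<open>The n-th powers of the scale cancel; the quarter in the distance bound leaves
    the power of 4.\<close>
  have B_eq: "B k * vol (Q k) = CK * 4 powr (real CARD('n) + \<delta>) * (L (l / 2) * S (2 * l)) * (2 powr (- real k * \<delta>) * E k)" for k
  proof -
    have "B k * vol (Q k) = CK * (L (l / 2) * S (2 * l) * E k) *
        (l powr \<delta> / (2 ^ k * l / 4) powr (real CARD('n) + \<delta>) * vol (Q k))"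
      by (simp add: B_def mult_ac)
    also have "l powr \<delta> / (2 ^ k * l / 4) powr (real CARD('n) + \<delta>) * vol (Q k) =
        l powr \<delta> * 4 powr (real CARD('n) + \<delta>) / (2 ^ k * l) powr \<delta>"
      using l by (simp add: vol_Q powr_divide powr_add)
    also have "\<dots> = 4 powr (real CARD('n) + \<delta>) * 2 powr (- real k * \<delta>)"
      using l by (simp add: powr_mult powr_realpow[symmetric] powr_powr powr_minus field_simps)
    finally show ?thesis by (simp add: mult_ac)
  qed
  have "bounded (supp f)" using f(1) by (auto simp: C0_def intro: compact_imp_bounded)
  then obtain R where R: "\<And>t. t \<in> supp f \<Longrightarrow> norm t \<le> R" unfolding bounded_iff by blast
  \<comment> \<open>\<open>M\<close> is large enough for the \<open>M\<close>-th dilate to contain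
    the compact support of \<open>f\<close>, so a finite sum suffices as majorant.\<close>
  obtain M :: nat where M: "(R + norm c) / (l / 2) < 2 ^ M"
    using real_arch_pow[of 2 "(R + norm c) / (l / 2)"] by auto
  \<comment> \<open>Whole nested cubes are summed instead of disjoint shells: all terms are
    nonnegative, so at each point the term of its own shell is already a lower bound for
    \<open>U\<close>.\<close>
  define U where "U t = (\<Sum>k\<le>M. a * B k * indicator (cube_set (Q k)) t)" for t
  have TU: "cmod (T f g) \<le> b * vol J * (LINT t|lborel. U t)"
  proof (rule far_pairing_bound[OF T cont J f(1) _ g])
    show "supp f \<inter> cube_set J = {}"
      using f(2) l by (fastforce simp: mem_cube_set l_def)
    show "0 \<le> U t" for t unfolding U_def using a B by (intro sum_nonneg) simp
    show "integrable lborel U"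
      unfolding U_def by (intro Bochner_Integration.integrable_sum) (simp add: integrable_indicator_cube)
    fix x t assume x: "x \<in> cube_set J" and t: "t \<in> supp f"
    \<comment> \<open>The smallest dyadic dilate containing \<^term>\<open>t\<close> has side comparable to its distance from \<^term>\<open>c\<close>.\<close>
    define k where "k = (LEAST k. infnorm (t - c) \<le> 2 ^ k * l / 2)"
    have "infnorm (t - c) \<le> norm (t - c)" by (rule infnorm_le_norm)
    also have "\<dots> \<le> R + norm c" using R[OF t] norm_triangle_ineq4[of t c] by simp
    also have "\<dots> \<le> 2 ^ M * l / 2" using M l by (simp add: field_simps)
    finally have tM: "infnorm (t - c) \<le> 2 ^ M * l / 2" .
    have kM: "k \<le> M" unfolding k_def using tM by (rule Least_le)
    have tk: "infnorm (t - c) \<le> 2 ^ k * l / 2" unfolding k_def using tM by (rule LeastI)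
    \<comment> \<open>For k = 0 the point would lie in \<open>J\<close>, against the distance
      assumption on \<open>supp f\<close>. So \<open>k\<close> has a predecessor, at which
      minimality gives the lower bound 2^k l / 4 for the distance.\<close>
    have "k \<noteq> 0"
    proof
      assume "k = 0"
      then show False using tk f(2)[OF t] l by (simp add: c_def l_def)
    qed
    then obtain k' where k': "k = Suc k'" using not0_implies_Suc by blast
    then have "\<not> infnorm (t - c) \<le> 2 ^ k' * l / 2"
      using not_less_Least[of k' "\<lambda>k. infnorm (t - c) \<le> 2 ^ k * l / 2"] by (simp add: k_def)
    then have tk': "2 ^ k * l / 4 \<le> infnorm (t - c)" by (simp add: k' mult.commute)
    have tQ: "t \<in> cube_set (Q k)" using tk by (simp add: mem_cube_set Q)
    have "cmod (K x t - K (centre J) t) \<le> B k"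
      unfolding B_def E_def l_def
      using l tk' tQ f(2)[OF t] centre_in_cube_set[of "Q k"]
      by (intro kernel_increment_bound[OF adm CK \<delta> K x]) (auto simp: Q l_def c_def)
    then have "cmod (f t) * cmod (K x t - K (centre J) t) \<le> a * B k * indicator (cube_set (Q k)) t"
      using f(3)[of t] a tQ by (auto intro!: mult_mono)
    also have "\<dots> \<le> U t"
      unfolding U_def using a B kM by (intro member_le_sum) auto
    finally show "cmod (f t) * cmod (K x t - K (centre J) t) \<le> U t" .
  qed
  have "(LINT t|lborel. U t) = (\<Sum>k\<le>M. a * (B k * vol (Q k)))"
    unfolding U_def using l
    by (subst Bochner_Integration.integral_sum) (auto simp: measure_cube_set Q integrable_indicator_cube mult.assoc)
  also have "\<dots> = a * (CK * 4 powr (real CARD('n) + \<delta>) * (L (l / 2) * S (2 * l)) *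
      (\<Sum>k\<le>M. 2 powr (- real k * \<delta>) * E k))"
    by (simp add: B_eq sum_distrib_left)
  \<comment> \<open>Passing to the full series removes \<open>M\<close>, and with it the dependence
    on the support of \<open>f\<close>.\<close>
  also have "\<dots> \<le> a * (CK * 4 powr (real CARD('n) + \<delta>) * (L (l / 2) * S (2 * l)) *
      (\<Sum>k. 2 powr (- real k * \<delta>) * E k))"
  proof (intro mult_left_mono)
    show "(\<Sum>k\<le>M. 2 powr (- real k * \<delta>) * E k) \<le> (\<Sum>k. 2 powr (- real k * \<delta>) * E k)"
      using summable_tilde_F_K[OF adm \<delta>, of J] l nonneg
      by (intro sum_le_suminf) (auto simp: E_def Q_def l_def)
  qed (use a CK nonneg in auto)
  also have "\<dots> = a * (CK * 4 powr (real CARD('n) + \<delta>) *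
    tilde_F_K \<delta> (\<lambda>y. L (y / 2)) (\<lambda>y. S (2 * y)) (\<lambda>y. D (y / 2)) J)"
    by (simp add: tilde_F_K_def tilde_F_K3_def E_def Q_def l_def mult_ac)
  finally have "b * vol J * (LINT t|lborel. U t) \<le> b * vol J * (a * (CK * 4 powr (real CARD('n) + \<delta>) *
    tilde_F_K \<delta> (\<lambda>y. L (y / 2)) (\<lambda>y. S (2 * y)) (\<lambda>y. D (y / 2)) J))"
    using b J by (intro mult_left_mono) (auto simp: vol_def is_cube_def)
  with TU show ?thesis by (simp add: mult_ac)
qed

section \<open>Weak compactness and the combined estimate\<close>

lemma bump0_le:
  assumes "is_cube I" "C \<ge> 0" "bump0 N I C \<phi>"
  shows "cmod (\<phi> x) \<le> C * vol I powr (- (1/2))"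
proof -
  have "1 \<le> (1 + infnorm (x - centre I) / side I) powr real N"
    using assms(1) by (intro ge_one_powr_ge_zero) (auto simp: is_cube_def infnorm_pos_le)
  then have "decay N I x \<le> 1" by (simp add: decay_def powr_minus inverse_le_1_iff)
  then have "C * vol I powr (- (1/2)) * decay N I x \<le> C * vol I powr (- (1/2)) * 1"
    using assms(2) by (intro mult_left_mono) auto
  with assms(3) show ?thesis unfolding bump0_def by (smt (verit))
qed

text \<open>Within distance 3 \<open>side J\<close> of the centre the decay factor is at least
  4^(-N), so on that region the constant \<open>4 ^ N\<close> absorbs it. The scalar turns the sup
  bound \<open>a\<close> into the L2 normalization of \<open>J\<close>.\<close>

lemma bump0_of_local:
  assumes J: "is_cube J" and f: "\<And>x. cmod (f x) \<le> a" "\<And>x. f x \<noteq> 0 \<Longrightarrow> infnorm (x - centre J) \<le> 3 * side J"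
    and "a > 0"
  shows "bump0 N J (4 ^ N) (\<lambda>x. of_real (vol J powr (- (1/2)) / a) * f x)"
  unfolding bump0_def
proof (intro conjI allI)
  have le: "cmod (of_real (vol J powr (- (1/2)) / a) * f x) \<le> vol J powr (- (1/2))" for x
    using f(1)[of x] \<open>a > 0\<close> by (simp add: norm_mult norm_divide divide_simps mult_right_mono mult.commute)
  then show "bounded (range (\<lambda>x. of_real (vol J powr (- (1/2)) / a) * f x))"
    unfolding bounded_iff by blast
  fix x
  show "cmod (of_real (vol J powr (- (1/2)) / a) * f x) \<le> 4 ^ N * vol J powr (- (1/2)) * decay N J x"
  proof (cases "f x = 0")
    case True
    then show ?thesis by (simp add: decay_def)
  next
    case False
    then have "infnorm (x - centre J) / side J \<le> 3"
      using f(2)[of x] J by (simp add: is_cube_def field_simps)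
    moreover have "0 \<le> infnorm (x - centre J) / side J"
      using J by (simp add: is_cube_def infnorm_pos_le)
    ultimately have "4 powr (- real N) \<le> decay N J x"
      unfolding decay_def by (intro powr_mono2') auto
    then have "4 ^ N * decay N J x \<ge> 4 ^ N * 4 powr (- real N)" by (intro mult_left_mono) auto
    then have "1 \<le> 4 ^ N * decay N J x" by (simp add: powr_minus powr_realpow)
    then have "vol J powr (- (1/2)) * 1 \<le> vol J powr (- (1/2)) * (4 ^ N * decay N J x)"
      by (intro mult_left_mono) auto
    with le[of x] show ?thesis by (simp add: mult_ac)
  qed
qed

lemma C0_scale: "f \<in> C0 \<Longrightarrow> (\<lambda>x. s * f x) \<in> C0"
proof -
  assume f: "f \<in> C0"
  have "compact (supp f \<inter> supp (\<lambda>x. s * f x))"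
    using f by (intro compact_Int_closed) (auto simp: C0_def supp_def)
  then show ?thesis
    using f supp_mult_subset[of "\<lambda>_. s" f] by (auto simp: C0_def Int_absorb1 intro: continuous_intros)
qed

lemma C0_operator_add:
  "C0_operator T \<Longrightarrow> f \<in> C0 \<Longrightarrow> f' \<in> C0 \<Longrightarrow> g \<in> C0 \<Longrightarrow> T (\<lambda>x. f x + f' x) g = T f g + T f' g"
  by (simp add: C0_operator_def C0_dual_def)

lemma C0_operator_scale:
  assumes "C0_operator T" "f \<in> C0" "g \<in> C0"
  shows "T (\<lambda>x. r * f x) (\<lambda>x. s * g x) = r * s * T f g"
proof -
  have "T (\<lambda>x. r * f x) (\<lambda>x. s * g x) = s * T (\<lambda>x. r * f x) g"
    using assms C0_scale[of f r] by (simp add: C0_operator_def C0_dual_def)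
  also have "T (\<lambda>x. r * f x) g = r * T f g"
    using assms by (simp add: C0_operator_def C0_dual_def)
  finally show ?thesis by simp
qed

text \<open>Both functions are rescaled to order 0 bumps adapted to \<open>J\<close>, and
  bilinearity moves the scalars out of the pairing. The two bump constants \<open>4 ^ N\<close>
  multiply to \<open>16 ^ N\<close>.\<close>

lemma near_pairing_bound:
  assumes T: "C0_operator T"
    and A: "\<And>I C \<phi> \<eta>. is_cube I \<Longrightarrow> C > 0 \<Longrightarrow> \<phi> \<in> C0 \<Longrightarrow> \<eta> \<in> C0 \<Longrightarrow>
      bump0 N I C \<phi> \<Longrightarrow> bump0 N I C \<eta> \<Longrightarrow> cmod (T \<phi> \<eta>) \<le> A * C\<^sup>2 * F\<^sub>W I"
    and J: "is_cube J"
    and f: "f \<in> C0" "\<And>x. f x \<noteq> 0 \<Longrightarrow> infnorm (x - centre J) \<le> 3 * side J" "\<And>x. cmod (f x) \<le> a" "a > 0"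
    and g: "g \<in> C0" "\<And>x. g x \<noteq> 0 \<Longrightarrow> infnorm (x - centre J) \<le> 3 * side J" "\<And>x. cmod (g x) \<le> b" "b > 0"
  shows "cmod (T f g) \<le> a * b * vol J * (A * 16 ^ N * F\<^sub>W J)"
proof -
  have v: "vol J > 0" using J by (simp add: vol_def is_cube_def)
  define r s where "r = vol J powr (- (1/2)) / a" and "s = vol J powr (- (1/2)) / b"
  have rs: "r > 0" "s > 0" using v f(4) g(4) by (auto simp: r_def s_def)
  have "vol J powr (- (1/2)) * vol J powr (- (1/2)) = vol J powr (- 1)"
    by (simp flip: powr_add)
  then have "vol J powr (- (1/2)) * vol J powr (- (1/2)) * vol J = 1"
    using v by (simp add: powr_minus)
  \<comment> \<open>The two factors \<open>vol J powr (- (1/2))\<close> cancel \<open>vol J\<close>,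
    so the scalars \<open>r\<close> and \<open>s\<close> exactly undo the prefactor of the
    claim.\<close>
  then have ab: "a * b * vol J * (r * s) = 1"
    using f(4) g(4) by (simp add: r_def s_def field_simps)
  have "r * s * cmod (T f g) = cmod (T (\<lambda>x. of_real r * f x) (\<lambda>x. of_real s * g x))"
    using rs by (simp add: C0_operator_scale[OF T f(1) g(1)] norm_mult)
  also have "\<dots> \<le> A * (4 ^ N)\<^sup>2 * F\<^sub>W J"
    unfolding r_def s_def
    by (intro A J C0_scale bump0_of_local f g) auto
  also have "(4 ^ N)\<^sup>2 = (16 ^ N :: real)" by (simp add: power_mult[symmetric] mult.commute[of N] power_mult)
  finally have "a * b * vol J * (r * s * cmod (T f g)) \<le> a * b * vol J * (A * 16 ^ N * F\<^sub>W J)"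
    using v f(4) g(4) by (intro mult_left_mono) auto
  moreover have "a * b * vol J * (r * s * cmod (T f g)) = cmod (T f g)"
    using ab by (metis mult.assoc mult_1)
  ultimately show ?thesis by simp
qed

text \<open>The function \<open>f\<close> is controlled by its sup bound \<open>a\<close> alone; a
  larger cube carrying it enters the estimate only through \<open>a\<close>.\<close>

lemma mean_zero_pairing_near:
  fixes K :: "real ^ ('n::{finite,linorder}) \<Rightarrow> real ^ ('n::{finite,linorder}) \<Rightarrow> complex"
  assumes adm: "admissible_LSD L S D" and CK: "CK > 0" and \<delta>: "\<delta> > 0"
    and K: "CZ_smooth CK \<delta> L S D K" and T: "C0_operator T" "associated_with T K"
    and A: "\<And>I C \<phi> \<eta>. is_cube I \<Longrightarrow> C > 0 \<Longrightarrow> \<phi> \<in> C0 \<Longrightarrow> \<eta> \<in> C0 \<Longrightarrow>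
      bump0 N I C \<phi> \<Longrightarrow> bump0 N I C \<eta> \<Longrightarrow> cmod (T \<phi> \<eta>) \<le> A * C\<^sup>2 * F\<^sub>W I"
    and J: "is_cube J"
    and f: "f \<in> C0" "\<And>x. cmod (f x) \<le> a" "a > 0"
    and g: "g \<in> C0" "supp g \<subseteq> cube_set J" "(LINT x|lborel. g x) = 0" "\<And>x. cmod (g x) \<le> b" "b > 0"
  shows "cmod (T f g) \<le> a * b * vol J * (A * 16 ^ N * F\<^sub>W J + CK * 4 powr (real CARD('n) + \<delta>) *
    tilde_F_K \<delta> (\<lambda>y. L (y / 2)) (\<lambda>y. S (2 * y)) (\<lambda>y. D (y / 2)) J)"
proof -
  \<comment> \<open>The cutoff is 1 up to distance 2 \<open>side J\<close> and 0 from 3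
    \<open>side J\<close> on. Hence \<open>f1\<close> meets the radius required by
    \<open>near_pairing_bound\<close>, and \<open>f2\<close> the separation required by
    \<open>far_estimate_dyadic\<close>.\<close>
  define h where "h x = max 0 (min 1 (3 - infnorm (x - centre J) / side J))" for x
  define f1 where "f1 x = of_real (h x) * f x" for x
  define f2 where "f2 x = of_real (1 - h x) * f x" for x
  have l: "side J > 0" using J by (simp add: is_cube_def)
  have h: "0 \<le> h x" "h x \<le> 1" for x by (auto simp: h_def)
  have hc: "continuous_on UNIV h" unfolding h_def using l by (intro continuous_intros) auto
  have C0: "f1 \<in> C0" "f2 \<in> C0"
  proof -
    have cpt: "compact (supp f \<inter> supp (\<lambda>x. u x * f x))" for u
      using f(1) by (intro compact_Int_closed) (auto simp: C0_def supp_def)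
    have "compact (supp (\<lambda>x. u x * f x))" for u
      using cpt[of u] supp_mult_subset[of u f] by (simp add: Int_absorb1)
    then show "f1 \<in> C0" "f2 \<in> C0"
      using f(1) hc by (auto simp: C0_def f1_def[abs_def] f2_def[abs_def] intro!: continuous_intros)
  qed
  have bound: "cmod (f1 x) \<le> a" "cmod (f2 x) \<le> a" for x
    using h[of x] f(2)[of x] mult_mono[of "h x" 1 "cmod (f x)" a] mult_mono[of "1 - h x" 1 "cmod (f x)" a]
    by (auto simp: f1_def f2_def norm_mult simp del: of_real_diff)
  have "cmod (T f1 g) \<le> a * b * vol J * (A * 16 ^ N * F\<^sub>W J)"
  proof (rule near_pairing_bound[OF T(1) A J C0(1) _ bound(1) f(3) g(1) _ g(4,5)])
    show "infnorm (x - centre J) \<le> 3 * side J" if "f1 x \<noteq> 0" for x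
    proof -
      have "h x \<noteq> 0" using that by (auto simp: f1_def)
      then have "infnorm (x - centre J) / side J < 3" by (auto simp: h_def max_def min_def split: if_splits)
      then show ?thesis using l by (simp add: field_simps)
    qed
    show "infnorm (x - centre J) \<le> 3 * side J" if "g x \<noteq> 0" for x
    proof -
      have "x \<in> cube_set J" using that C0_vanishes[of x g] g(2) by blast
      then show ?thesis using l by (simp add: mem_cube_set)
    qed
  qed
  moreover have "cmod (T f2 g) \<le> a * b * vol J * (CK * 4 powr (real CARD('n) + \<delta>) *
    tilde_F_K \<delta> (\<lambda>y. L (y / 2)) (\<lambda>y. S (2 * y)) (\<lambda>y. D (y / 2)) J)"
  proof (rule far_estimate_dyadic[OF adm CK \<delta> K T(2) _ J C0(2) _ bound(2) g(1-4)])
    show "continuous_on {p. fst p \<noteq> snd p} (\<lambda>p. K (fst p) (snd p))"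
      by (rule CZ_smooth_continuous[OF adm K CK \<delta>])
    fix t assume t: "t \<in> supp f2"
    \<comment> \<open>The support is a closure, so it is enclosed in a closed set; the radius 2
      \<open>side J\<close> leaves room for the strict inequality.\<close>
    have "supp f2 \<subseteq> {x. 2 * side J \<le> infnorm (x - centre J)}"
      unfolding supp_def
    proof (rule closure_minimal)
      show "closed {x. 2 * side J \<le> infnorm (x - centre J)}"
        by (intro closed_Collect_le continuous_intros)
      show "{x. f2 x \<noteq> 0} \<subseteq> {x. 2 * side J \<le> infnorm (x - centre J)}"
      proof clarsimp
        fix x assume "f2 x \<noteq> 0"
        then have "h x \<noteq> 1" by (auto simp: f2_def)
        then have "2 < infnorm (x - centre J) / side J" by (auto simp: h_def max_def min_def split: if_splits)
        then show "2 * side J \<le> infnorm (x - centre J)"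
          using l by (simp add: field_simps)
      qed
    qed
    with t l show "side J < infnorm (t - centre J)" by auto
  qed
  moreover have "T f g = T f1 g + T f2 g"
    using C0_operator_add[OF T(1) C0 g(1)] by (simp add: f1_def f2_def ring_distribs)
  ultimately show ?thesis
    using norm_triangle_ineq[of "T f1 g" "T f2 g"] by (simp add: distrib_left)
qed

section \<open>Both cases for ordered side lengths, with one constant\<close>

lemma ec_powr:
  fixes I J :: "('n::finite) cube"
  assumes "is_cube I" "is_cube J" "side J \<le> side I"
  shows "ec I J powr p = side J powr (real CARD('n) * p) / side I powr (real CARD('n) * p)"
proof -
  have "vol J \<le> vol I" using assms by (simp add: vol_def is_cube_def power_mono)
  then have "ec I J = vol J / vol I" by (simp add: ec_def)
  then show ?thesis
    using assms by (simp add: vol_def is_cube_def powr_divide powr_powr flip: powr_realpow)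
qed

lemma mean_zero_pairing:
  fixes K :: "real ^ ('n::{finite,linorder}) \<Rightarrow> real ^ ('n::{finite,linorder}) \<Rightarrow> complex"
  defines "n \<equiv> real CARD('n)"
  assumes adm: "admissible_LSD L S D" and \<delta>: "\<delta> > 0" and CK: "CK > 0" "CZ_smooth CK \<delta> L S D K"
    and T: "C0_operator T" "associated_with T K" and W: "weak_compactness N T F\<^sub>W"
  defines "FK \<equiv> F_K (\<lambda>y. L (y / 2)) (\<lambda>y. S (2 * y)) (\<lambda>y. D (y / 2))"
    and "tFK \<equiv> tilde_F_K \<delta> (\<lambda>y. L (y / 2)) (\<lambda>y. S (2 * y)) (\<lambda>y. D (y / 2))"
  obtains A where "A > 0"
    "\<And>I J f g C. is_cube I \<Longrightarrow> is_cube J \<Longrightarrow> C > 0 \<Longrightarrow> side J \<le> side I \<Longrightarrow>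
      continuous_on UNIV f \<Longrightarrow> bump0 N I C f \<Longrightarrow> supp f \<subseteq> cube_set I \<Longrightarrow>
      continuous_on UNIV g \<Longrightarrow> bump0 N J C g \<Longrightarrow> supp g \<subseteq> cube_set J \<Longrightarrow>
      (LINT x|lborel. g x) = 0 \<Longrightarrow>
      (rdist I J \<le> 3 \<longrightarrow> cmod (T f g) \<le>
         A * C\<^sup>2 * (ec I J powr (1/2) / rdist I J powr (n + \<delta>)) * (tFK J + F\<^sub>W J + FK J J I)) \<and>
      (rdist I J > 3 \<longrightarrow> cmod (T f g) \<le>
         A * C\<^sup>2 * (ec I J powr (1/2 + \<delta> / n) / rdist I J powr (n + \<delta>)) *
         FK (cube_join I J) J (cube_join I J))"
proof -
  obtain Aw where "Aw > 0" and Aw: "\<forall>I C \<phi> \<eta>. is_cube I \<and> C > 0 \<and> \<phi> \<in> C0 \<and> \<eta> \<in> C0 \<and>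
      bump0 N I C \<phi> \<and> bump0 N I C \<eta> \<longrightarrow> cmod (T \<phi> \<eta>) \<le> Aw * C\<^sup>2 * F\<^sub>W I"
    using W unfolding weak_compactness_def by (elim conjE exE) (rule that)
  have F_W: "F\<^sub>W I \<ge> 0" if "is_cube I" for I
    using W that unfolding weak_compactness_def by (elim conjE) simp
  define p where "p = n + \<delta>"
  \<comment> \<open>\<open>A0\<close> adds the weak compactness constant and the kernel constant;
    the factor \<open>3 powr p\<close> in \<open>A\<close> pays for the power of
    \<open>rdist I J\<close> in the near case.\<close>
  define A0 where "A0 = Aw * 16 ^ N + CK * 4 powr p"
  define A where "A = 3 powr p * A0"
  have n: "n > 0" by (simp add: n_def)
  have A0: "A0 > 0" using \<open>Aw > 0\<close> CK(1) by (simp add: A0_def add_pos_pos)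
  have rdu: "0 \<le> rdist Q unit_cube" if "side Q \<ge> 0" for Q :: "'n cube"
    unfolding rdist_commute[of Q] using rdist_ge_1[of unit_cube Q] that by (simp add: unit_cube_def)
  have FK_nonneg: "0 \<le> FK Q1 Q2 Q3" if "side Q1 \<ge> 0" "side Q2 \<ge> 0" "side Q3 \<ge> 0" for Q1 Q2 Q3
    using adm that rdu by (auto simp: FK_def F_K_def admissible_LSD_def)
  have tFK_nonneg: "0 \<le> tFK Q" if "side Q \<ge> 0" for Q
  proof -
    have "0 \<le> (\<Sum>j. 2 powr (- real j * \<delta>) * D (rdist (dilate (2 ^ j) Q) unit_cube / 2))"
    proof (rule suminf_nonneg[OF summable_tilde_F_K[OF adm \<delta> that]])
      show "0 \<le> 2 powr (- real j * \<delta>) * D (rdist (dilate (2 ^ j) Q) unit_cube / 2)" for j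
        using adm that rdu[of "dilate (2 ^ j) Q"] by (simp add: admissible_LSD_def dilate_def)
    qed
    then show ?thesis
      using adm that by (simp add: tFK_def tilde_F_K_def tilde_F_K3_def admissible_LSD_def)
  qed
  show thesis
  proof (rule that[of A])
    show "A > 0" using A0 by (simp add: A_def)
    fix I J :: "'n cube" and f g and C :: real
    assume *: "is_cube I" "is_cube J" "C > 0" "side J \<le> side I"
      "continuous_on UNIV f" "bump0 N I C f" "supp f \<subseteq> cube_set I"
      "continuous_on UNIV g" "bump0 N J C g" "supp g \<subseteq> cube_set J" "(LINT x|lborel. g x) = 0"
    have s: "side I > 0" "side J > 0" using * by (auto simp: is_cube_def)
    have vol: "vol I = side I powr n" "vol J = side J powr n"
      using s by (simp_all add: vol_def powr_realpow n_def)
    define a where "a = C * vol I powr (- (1/2))"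
    define b where "b = C * vol J powr (- (1/2))"
    have ab: "a > 0" "b > 0" using * s by (simp_all add: a_def b_def vol)
    have f: "cmod (f x) \<le> a" and g: "cmod (g x) \<le> b" for x
      unfolding a_def b_def using * by (intro bump0_le; simp)+
    have C0: "f \<in> C0" "g \<in> C0" using * C0_I by blast+
    have rd: "rdist I J \<ge> 1" using s by (intro rdist_ge_1) auto
    define e where "e = ec I J"
    have e: "e powr q = side J powr (n * q) / side I powr (n * q)" for q
      using ec_powr[OF *(1,2,4)] by (simp add: e_def n_def)
    show "(rdist I J \<le> 3 \<longrightarrow> cmod (T f g) \<le>
         A * C\<^sup>2 * (ec I J powr (1/2) / rdist I J powr (n + \<delta>)) * (tFK J + F\<^sub>W J + FK J J I)) \<and>
      (rdist I J > 3 \<longrightarrow> cmod (T f g) \<le>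
         A * C\<^sup>2 * (ec I J powr (1/2 + \<delta> / n) / rdist I J powr (n + \<delta>)) *
         FK (cube_join I J) J (cube_join I J))"
    proof (intro conjI impI)
      assume rd3: "rdist I J \<le> 3"
      have nn: "0 \<le> tFK J" "0 \<le> F\<^sub>W J" "0 \<le> FK J J I"
        using tFK_nonneg FK_nonneg F_W * s by auto
      have "cmod (T f g) \<le> a * b * vol J * (Aw * 16 ^ N * F\<^sub>W J + CK * 4 powr p * tFK J)"
        unfolding p_def n_def tFK_def
        by (rule mean_zero_pairing_near[OF adm CK(1) \<delta> CK(2) T _ *(2) C0(1) f ab(1) C0(2) *(10,11) g ab(2)])
           (use Aw in auto)
      \<comment> \<open>The sup bounds contribute \<open>vol I powr (- (1/2))\<close> and
        \<open>vol J powr (- (1/2))\<close>; together with \<open>vol J\<close> they give the square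
        root of the volume ratio, which is the eccentricity.\<close>
      also have "a * b * vol J = C\<^sup>2 * e powr (1/2)"
      proof -
        have "vol J powr (- (1/2)) * vol J = vol J powr (1/2)"
          using s by (simp add: vol powr_powr flip: powr_add)
        moreover have "a * b * vol J = C\<^sup>2 * (vol J powr (- (1/2)) * vol J / vol I powr (1/2))"
          by (simp add: a_def b_def power2_eq_square powr_minus_divide)
        ultimately have "a * b * vol J = C\<^sup>2 * (vol J powr (1/2) / vol I powr (1/2))" by simp
        then show ?thesis by (simp add: e vol powr_powr)
      qed
      also have "C\<^sup>2 * e powr (1/2) * (Aw * 16 ^ N * F\<^sub>W J + CK * 4 powr p * tFK J) \<le>
          C\<^sup>2 * e powr (1/2) * (A0 * (tFK J + F\<^sub>W J + FK J J I))"
      proof (intro mult_left_mono)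
        have "Aw * 16 ^ N * F\<^sub>W J \<le> A0 * F\<^sub>W J" "CK * 4 powr p * tFK J \<le> A0 * tFK J" "0 \<le> A0 * FK J J I"
          using nn \<open>Aw > 0\<close> CK(1) A0 by (auto simp: A0_def intro!: mult_right_mono)
        then show "Aw * 16 ^ N * F\<^sub>W J + CK * 4 powr p * tFK J \<le> A0 * (tFK J + F\<^sub>W J + FK J J I)"
          by (simp add: distrib_left)
      qed auto
      also have "\<dots> = C\<^sup>2 * (e powr (1/2) * 1) * (A0 * (tFK J + F\<^sub>W J + FK J J I))"
        by simp
      \<comment> \<open>As \<open>rdist I J\<close> is at most 3, the decay factor can be inserted
        at the cost of \<open>3 powr p\<close>.\<close>
      also have "\<dots> \<le> C\<^sup>2 * (e powr (1/2) * (3 powr p / rdist I J powr p)) * (A0 * (tFK J + F\<^sub>W J + FK J J I))"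
      proof (intro mult_right_mono mult_left_mono)
        have "rdist I J powr p \<le> 3 powr p"
          using rd rd3 n \<delta> by (intro powr_mono2) (auto simp: p_def)
        then show "1 \<le> 3 powr p / rdist I J powr p" using rd by simp
      qed (use nn A0 in auto)
      finally show "cmod (T f g) \<le>
         A * C\<^sup>2 * (ec I J powr (1/2) / rdist I J powr (n + \<delta>)) * (tFK J + F\<^sub>W J + FK J J I)"
        by (simp add: A_def e_def p_def mult_ac)
    next
      assume rd3: "rdist I J > 3"
      define d where "d = side (cube_join I J)"
      have rd_eq: "rdist I J = d / side I" using *(4) by (simp add: rdist_def d_def max_absorb1)
      then have "0 < d / side I" using rd3 by simp
      then have d: "d > 0" using s by (simp add: zero_less_divide_iff)
      have FK0: "0 \<le> FK (cube_join I J) J (cube_join I J)"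
        using d s by (intro FK_nonneg) (auto simp: d_def)
      have "cmod (T f g) \<le> a * b * (vol I * vol J) * (CK * 2 powr p * (side J powr \<delta> / d powr p)) *
          FK (cube_join I J) J (cube_join I J)"
        unfolding p_def n_def FK_def d_def
        by (rule far_estimate_separated[OF adm CK(1) \<delta> CK(2) T(2)
              CZ_smooth_continuous[OF adm CK(2,1) \<delta>] *(1,2,4) rd3 C0(1) *(7) f C0(2) *(10,11) g])
      \<comment> \<open>The normalized volumes give (side I * side J)^(n/2). Writing
        \<open>d\<close> as \<open>rdist I J * side I\<close> splits off side I^(-(n + \<delta>)),
        and the remaining powers form (side J / side I)^(n/2 + \<delta>), the eccentricity to the
        power 1/2 + \<delta>/n.\<close>
      also have "a * b * (vol I * vol J) * (CK * 2 powr p * (side J powr \<delta> / d powr p)) =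
          CK * 2 powr p * C\<^sup>2 * (e powr (1/2 + \<delta> / n) / rdist I J powr p)"
      proof -
        have v: "vol Q powr (- (1/2)) * vol Q = side Q powr (n / 2)" if "Q = I \<or> Q = J" for Q
          using s that by (auto simp: vol powr_powr simp flip: powr_add)
        have "a * b * (vol I * vol J) = C\<^sup>2 * ((vol I powr (- (1/2)) * vol I) * (vol J powr (- (1/2)) * vol J))"
          by (simp add: a_def b_def power2_eq_square)
        also have "\<dots> = C\<^sup>2 * (side I powr (n / 2) * side J powr (n / 2))" by (simp add: v)
        finally have 1: "a * b * (vol I * vol J) = C\<^sup>2 * (side I powr (n / 2) * side J powr (n / 2))" .
        have "n * (1/2 + \<delta> / n) = n / 2 + \<delta>" using n by (simp add: distrib_left)
        then have "e powr (1/2 + \<delta> / n) / rdist I J powr p =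
            side J powr (n / 2 + \<delta>) / side I powr (n / 2 + \<delta>) * (side I powr p / d powr p)"
          using s d by (simp add: e rd_eq powr_divide)
        also have "side I powr p = side I powr (n / 2 + \<delta>) * side I powr (n / 2)"
          by (simp add: p_def flip: powr_add)
        finally have "e powr (1/2 + \<delta> / n) / rdist I J powr p =
            side I powr (n / 2) * side J powr (n / 2) * (side J powr \<delta> / d powr p)"
          using s by (simp add: powr_add)
        with 1 show ?thesis by simp
      qed
      also have "\<dots> * FK (cube_join I J) J (cube_join I J) \<le>
          A * C\<^sup>2 * (e powr (1/2 + \<delta> / n) / rdist I J powr p) * FK (cube_join I J) J (cube_join I J)"
      proof (intro mult_right_mono FK0)
        have "CK * 2 powr p \<le> CK * 4 powr p"
          using CK(1) n \<delta> by (intro mult_left_mono powr_mono2) (auto simp: p_def)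
        also have "\<dots> \<le> A0" using \<open>Aw > 0\<close> by (simp add: A0_def)
        also have "\<dots> \<le> A"
          using A0 ge_one_powr_ge_zero[of 3 p] n \<delta> by (simp add: A_def p_def)
        finally show "CK * 2 powr p \<le> A" .
      qed auto
      finally show "cmod (T f g) \<le>
         A * C\<^sup>2 * (ec I J powr (1/2 + \<delta> / n) / rdist I J powr (n + \<delta>)) *
         FK (cube_join I J) J (cube_join I J)"
        by (simp add: e_def p_def)
    qed
  qed
qed

section \<open>Either cube may be the smaller one\<close>

theorem proposition3p2:
  fixes \<delta> :: real
  assumes "0 < \<delta>" and "\<delta> < 1"
  shows "\<exists>\<kappa>. 0 < \<kappa> \<and> \<kappa> \<le> 1 \<and>
    (\<forall>(K :: real ^ ('n::{finite,linorder}) \<Rightarrow> real ^ ('n::{finite,linorder}) \<Rightarrow> complex) L S D T F\<^sub>W N \<alpha>.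
      compact_CZ_kernel \<delta> L S D K \<and> C0_operator T \<and> associated_with T K \<and>
      weak_compactness N T F\<^sub>W \<and> \<delta> < \<alpha> \<and> \<alpha> \<le> 1 \<longrightarrow>
      (let FK = F_K (\<lambda>y. L (\<kappa> * y)) (\<lambda>y. S (y / \<kappa>)) (\<lambda>y. D (\<kappa> * y));
           tFK = tilde_F_K \<delta> (\<lambda>y. L (\<kappa> * y)) (\<lambda>y. S (y / \<kappa>)) (\<lambda>y. D (\<kappa> * y));
           n = real CARD('n)
       in \<exists>A>0. \<forall>I J \<psi>\<^sub>I \<psi>\<^sub>J C.
            is_cube I \<and> is_cube J \<and> C > 0 \<and>
            bump1 N \<alpha> I C \<psi>\<^sub>I \<and> supp \<psi>\<^sub>I \<subseteq> cube_set I \<and>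
            bump1 N \<alpha> J C \<psi>\<^sub>J \<and> supp \<psi>\<^sub>J \<subseteq> cube_set J \<and>
            (LINT x|lborel. (if side J \<le> side I then \<psi>\<^sub>J x else \<psi>\<^sub>I x)) = 0 \<longrightarrow>
            (rdist I J \<le> 3 \<longrightarrow>
               cmod (T \<psi>\<^sub>I \<psi>\<^sub>J) \<le>
                 A * C\<^sup>2 * (ec I J powr (1/2) / rdist I J powr (n + \<delta>)) *
                 (tFK (smaller I J) + F\<^sub>W (smaller I J) +
                  FK (smaller I J) (smaller I J) (larger I J))) \<and>
            (rdist I J > 3 \<longrightarrow>
               cmod (T \<psi>\<^sub>I \<psi>\<^sub>J) \<le>
                 A * C\<^sup>2 * (ec I J powr (1/2 + \<delta> / n) / rdist I J powr (n + \<delta>)) *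
                 FK (cube_join I J) (smaller I J) (cube_join I J))))"
\<comment> \<open>The witness 1/2 comes from the halved relative distance in
  \<open>rdist_unit_cube_le\<close> and the halved arguments of \<open>L\<close> in the two far
  estimates.\<close>
proof (intro exI[of _ "1/2 :: real"] conjI allI impI)
  show "0 < (1/2 :: real)" "(1/2 :: real) \<le> 1" by simp_all
  fix K :: "real ^ ('n::{finite,linorder}) \<Rightarrow> real ^ ('n::{finite,linorder}) \<Rightarrow> complex" and L S D T F\<^sub>W N \<alpha>
  assume *: "compact_CZ_kernel \<delta> L S D K \<and> C0_operator T \<and> associated_with T K \<and>
      weak_compactness N T F\<^sub>W \<and> \<delta> < \<alpha> \<and> \<alpha> \<le> 1"
  define n where "n = real CARD('n)"
  define FK :: "'n cube \<Rightarrow> 'n cube \<Rightarrow> 'n cube \<Rightarrow> real" where "FK = F_K (\<lambda>y. L (1/2 * y)) (\<lambda>y. S (y / (1/2))) (\<lambda>y. D (1/2 * y))"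
  define tFK :: "'n cube \<Rightarrow> real" where "tFK = tilde_F_K \<delta> (\<lambda>y. L (1/2 * y)) (\<lambda>y. S (y / (1/2))) (\<lambda>y. D (1/2 * y))"
  have FK: "F_K (\<lambda>y. L (y / 2)) (\<lambda>y. S (2 * y)) (\<lambda>y. D (y / 2)) = FK"
    and tFK: "tilde_F_K \<delta> (\<lambda>y. L (y / 2)) (\<lambda>y. S (2 * y)) (\<lambda>y. D (y / 2)) = tFK"
    by (simp_all add: FK_def tFK_def comp_def mult.commute)
  have adm: "admissible_LSD L S D" using * by (simp add: compact_CZ_kernel_def)
  from * obtain CK where CK: "CK > 0" "CZ_smooth CK \<delta> L S D K" using compact_CZ_kernel_smooth by blast
  have T: "C0_operator T" "associated_with T K" "weak_compactness N T F\<^sub>W" using * by simp_all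
  \<comment> \<open>The transposed data keep the same \<open>L\<close>, \<open>S\<close>,
    \<open>D\<close> and \<open>F\<^sub>W\<close>, so the second application of
    \<open>mean_zero_pairing\<close> yields the same \<open>FK\<close> and \<open>tFK\<close>,
    possibly with another constant.\<close>
  have T': "C0_operator (\<lambda>f g. T g f)" "associated_with (\<lambda>f g. T g f) (\<lambda>x t. K t x)"
      "weak_compactness N (\<lambda>f g. T g f) F\<^sub>W"
    using T CZ_smooth_continuous[OF adm CK(2,1) \<open>0 < \<delta>\<close>]
    by (auto intro: C0_operator_transpose associated_with_transpose weak_compactness_transpose)
  obtain A1 where A1: "A1 > 0" "\<And>I J f g C. is_cube I \<Longrightarrow> is_cube J \<Longrightarrow> C > 0 \<Longrightarrow> side J \<le> side I \<Longrightarrow>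
      continuous_on UNIV f \<Longrightarrow> bump0 N I C f \<Longrightarrow> supp f \<subseteq> cube_set I \<Longrightarrow>
      continuous_on UNIV g \<Longrightarrow> bump0 N J C g \<Longrightarrow> supp g \<subseteq> cube_set J \<Longrightarrow>
      (LINT x|lborel. g x) = 0 \<Longrightarrow>
      (rdist I J \<le> 3 \<longrightarrow> cmod (T f g) \<le>
         A1 * C\<^sup>2 * (ec I J powr (1/2) / rdist I J powr (n + \<delta>)) * (tFK J + F\<^sub>W J + FK J J I)) \<and>
      (rdist I J > 3 \<longrightarrow> cmod (T f g) \<le>
         A1 * C\<^sup>2 * (ec I J powr (1/2 + \<delta> / n) / rdist I J powr (n + \<delta>)) *
         FK (cube_join I J) J (cube_join I J))"
    by (rule mean_zero_pairing[OF adm \<open>0 < \<delta>\<close> CK T, unfolded FK tFK, folded n_def]) (rule that)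
  obtain A2 where A2: "A2 > 0" "\<And>I J f g C. is_cube I \<Longrightarrow> is_cube J \<Longrightarrow> C > 0 \<Longrightarrow> side J \<le> side I \<Longrightarrow>
      continuous_on UNIV f \<Longrightarrow> bump0 N I C f \<Longrightarrow> supp f \<subseteq> cube_set I \<Longrightarrow>
      continuous_on UNIV g \<Longrightarrow> bump0 N J C g \<Longrightarrow> supp g \<subseteq> cube_set J \<Longrightarrow>
      (LINT x|lborel. g x) = 0 \<Longrightarrow>
      (rdist I J \<le> 3 \<longrightarrow> cmod (T g f) \<le>
         A2 * C\<^sup>2 * (ec I J powr (1/2) / rdist I J powr (n + \<delta>)) * (tFK J + F\<^sub>W J + FK J J I)) \<and>
      (rdist I J > 3 \<longrightarrow> cmod (T g f) \<le>
         A2 * C\<^sup>2 * (ec I J powr (1/2 + \<delta> / n) / rdist I J powr (n + \<delta>)) *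
         FK (cube_join I J) J (cube_join I J))"
    by (rule mean_zero_pairing[OF adm \<open>0 < \<delta>\<close> CK(1) CZ_smooth_transpose[OF CK(2)] T', unfolded FK tFK, folded n_def])
       (rule that)
  \<comment> \<open>Enlarging the constant requires the rest of the right-hand side to be
    nonnegative. This follows from the estimate itself: it bounds the nonnegative \<open>u\<close>,
    and \<open>A\<close> is positive.\<close>
  have weaken: "u \<le> (A1 + A2) * c * e * F" if "u \<le> A * c * e * F" "A = A1 \<or> A = A2" "0 \<le> u" "c > 0" "e > 0"
    for u A c e F :: real
  proof -
    have "0 \<le> A * (c * e * F)" using that(1,3) by (simp add: mult.assoc)
    then have "0 \<le> c * e * F" using that(2) A1(1) A2(1) by (auto simp: zero_le_mult_iff)
    then have "A * (c * e * F) \<le> (A1 + A2) * (c * e * F)"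
      using that(2) A1(1) A2(1) by (intro mult_right_mono) auto
    then show ?thesis using that(1) by (simp add: mult.assoc)
  qed
  have "\<exists>A>0. \<forall>I J \<psi>\<^sub>I \<psi>\<^sub>J C.
            is_cube I \<and> is_cube J \<and> C > 0 \<and>
            bump1 N \<alpha> I C \<psi>\<^sub>I \<and> supp \<psi>\<^sub>I \<subseteq> cube_set I \<and>
            bump1 N \<alpha> J C \<psi>\<^sub>J \<and> supp \<psi>\<^sub>J \<subseteq> cube_set J \<and>
            (LINT x|lborel. (if side J \<le> side I then \<psi>\<^sub>J x else \<psi>\<^sub>I x)) = 0 \<longrightarrow>
            (rdist I J \<le> 3 \<longrightarrow>
               cmod (T \<psi>\<^sub>I \<psi>\<^sub>J) \<le>
                 A * C\<^sup>2 * (ec I J powr (1/2) / rdist I J powr (n + \<delta>)) *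
                 (tFK (smaller I J) + F\<^sub>W (smaller I J) +
                  FK (smaller I J) (smaller I J) (larger I J))) \<and>
            (rdist I J > 3 \<longrightarrow>
               cmod (T \<psi>\<^sub>I \<psi>\<^sub>J) \<le>
                 A * C\<^sup>2 * (ec I J powr (1/2 + \<delta> / n) / rdist I J powr (n + \<delta>)) *
                 FK (cube_join I J) (smaller I J) (cube_join I J))"
  proof (intro exI[of _ "A1 + A2"] conjI allI impI)
    show "0 < A1 + A2" using A1(1) A2(1) by simp
    fix I J :: "'n cube" and \<psi>\<^sub>I \<psi>\<^sub>J and C :: real
    assume H: "is_cube I \<and> is_cube J \<and> C > 0 \<and>
            bump1 N \<alpha> I C \<psi>\<^sub>I \<and> supp \<psi>\<^sub>I \<subseteq> cube_set I \<and>
            bump1 N \<alpha> J C \<psi>\<^sub>J \<and> supp \<psi>\<^sub>J \<subseteq> cube_set J \<and>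
            (LINT x|lborel. (if side J \<le> side I then \<psi>\<^sub>J x else \<psi>\<^sub>I x)) = 0"
    then have b: "continuous_on UNIV \<psi>\<^sub>I" "bump0 N I C \<psi>\<^sub>I" "continuous_on UNIV \<psi>\<^sub>J" "bump0 N J C \<psi>\<^sub>J"
      by (simp_all add: bump1_def)
    have pos: "0 < C\<^sup>2" "ec I J > 0" "rdist I J > 0"
      using H rdist_ge_1[of I J] by (auto simp: ec_def vol_def is_cube_def less_max_iff_disj intro!: divide_pos_pos)
    have "\<exists>A. (A = A1 \<or> A = A2) \<and>
      (rdist I J \<le> 3 \<longrightarrow> cmod (T \<psi>\<^sub>I \<psi>\<^sub>J) \<le>
         A * C\<^sup>2 * (ec I J powr (1/2) / rdist I J powr (n + \<delta>)) *
         (tFK (smaller I J) + F\<^sub>W (smaller I J) + FK (smaller I J) (smaller I J) (larger I J))) \<and>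
      (rdist I J > 3 \<longrightarrow> cmod (T \<psi>\<^sub>I \<psi>\<^sub>J) \<le>
         A * C\<^sup>2 * (ec I J powr (1/2 + \<delta> / n) / rdist I J powr (n + \<delta>)) *
         FK (cube_join I J) (smaller I J) (cube_join I J))"
    proof (cases "side J \<le> side I")
      case True
      then show ?thesis
        using A1(2)[of I J C \<psi>\<^sub>I \<psi>\<^sub>J] H b by (intro exI[of _ A1]) (simp add: smaller_def larger_def)
    next
      case False
      then show ?thesis
        \<comment> \<open>Here \<open>I\<close> is strictly smaller, so the transposed estimate is
          used with the cubes and the functions exchanged.\<close>
        using A2(2)[of J I C \<psi>\<^sub>J \<psi>\<^sub>I] H b
        by (intro exI[of _ A2])
           (simp add: smaller_def larger_def rdist_commute[of J I] ec_commute[of J I] cube_join_commute[of J I])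
    qed
    then obtain A where A: "A = A1 \<or> A = A2"
      "rdist I J \<le> 3 \<Longrightarrow> cmod (T \<psi>\<^sub>I \<psi>\<^sub>J) \<le>
         A * C\<^sup>2 * (ec I J powr (1/2) / rdist I J powr (n + \<delta>)) *
         (tFK (smaller I J) + F\<^sub>W (smaller I J) + FK (smaller I J) (smaller I J) (larger I J))"
      "rdist I J > 3 \<Longrightarrow> cmod (T \<psi>\<^sub>I \<psi>\<^sub>J) \<le>
         A * C\<^sup>2 * (ec I J powr (1/2 + \<delta> / n) / rdist I J powr (n + \<delta>)) *
         FK (cube_join I J) (smaller I J) (cube_join I J)"
      by blast
    show "cmod (T \<psi>\<^sub>I \<psi>\<^sub>J) \<le> (A1 + A2) * C\<^sup>2 * (ec I J powr (1/2) / rdist I J powr (n + \<delta>)) *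
         (tFK (smaller I J) + F\<^sub>W (smaller I J) + FK (smaller I J) (smaller I J) (larger I J))"
      if "rdist I J \<le> 3"
      by (rule weaken[OF A(2)[OF that] A(1)]) (use pos in auto)
    show "cmod (T \<psi>\<^sub>I \<psi>\<^sub>J) \<le> (A1 + A2) * C\<^sup>2 * (ec I J powr (1/2 + \<delta> / n) / rdist I J powr (n + \<delta>)) *
         FK (cube_join I J) (smaller I J) (cube_join I J)"
      if "3 < rdist I J"
      by (rule weaken[OF A(3)[OF that] A(1)]) (use pos in auto)
  qed
  then show "let FK = F_K (\<lambda>y. L (1/2 * y)) (\<lambda>y. S (y / (1/2))) (\<lambda>y. D (1/2 * y));
           tFK = tilde_F_K \<delta> (\<lambda>y. L (1/2 * y)) (\<lambda>y. S (y / (1/2))) (\<lambda>y. D (1/2 * y));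
           n = real CARD('n)
       in \<exists>A>0. \<forall>I J \<psi>\<^sub>I \<psi>\<^sub>J C.
            is_cube I \<and> is_cube J \<and> C > 0 \<and>
            bump1 N \<alpha> I C \<psi>\<^sub>I \<and> supp \<psi>\<^sub>I \<subseteq> cube_set I \<and>
            bump1 N \<alpha> J C \<psi>\<^sub>J \<and> supp \<psi>\<^sub>J \<subseteq> cube_set J \<and>
            (LINT x|lborel. (if side J \<le> side I then \<psi>\<^sub>J x else \<psi>\<^sub>I x)) = 0 \<longrightarrow>
            (rdist I J \<le> 3 \<longrightarrow>
               cmod (T \<psi>\<^sub>I \<psi>\<^sub>J) \<le>
                 A * C\<^sup>2 * (ec I J powr (1/2) / rdist I J powr (n + \<delta>)) *
                 (tFK (smaller I J) + F\<^sub>W (smaller I J) +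
                  FK (smaller I J) (smaller I J) (larger I J))) \<and>
            (rdist I J > 3 \<longrightarrow>
               cmod (T \<psi>\<^sub>I \<psi>\<^sub>J) \<le>
                 A * C\<^sup>2 * (ec I J powr (1/2 + \<delta> / n) / rdist I J powr (n + \<delta>)) *
                 FK (cube_join I J) (smaller I J) (cube_join I J))"
    unfolding Let_def FK_def tFK_def n_def .
qed

end
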